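(* Let $X$ be a finite nonempty set. For every finitely generated subgroup $G$ of $\mathfrak{BA}(X)$ there exists a positive integer $N$ such that $G$ is isomorphic to a subgroup of the permutational wreath product $\mathfrak M(X^N)\wr\mathrm{Sym}(X^N)$, where $\mathfrak M(X^N)$ is the Mother group over the alphabet $X^N$.
   Context: Let $X$ be a finite set (the alphabet). The homogeneous rooted tree $T=T(X)$ has vertex set $X^*$ (all finite words over $X$, root the empty word), with an edge joining $w$ to $wx$ for all $w\in X^*$, $x\in X$. Let $\mathfrak W(X)=\mathrm{Aut}(T)$ be the group of automorphisms of the rooted tree $T$, with the product $\alpha\beta$ meaning first $\alpha$, then $\beta$. For $\alpha\in\mathfrak W(X)$ and $w\in X^*$, the state $\alpha_w\in\mathfrak W(X)$ is defined by $\alpha(ww')=\alpha(w)\,\alpha_w(w')$ for all $w'\in X^*$. An automorphism $\alpha$ is automatic if its set of states $\{\alpha_w : w\in X^*\}$ is finite. It is bounded if the cardinalities of the sets $\{w\in X^n : \alpha_w\neq 1\}$ are bounded uniformly over all $n$. $\mathfrak{BA}(X)$ is the group of all automorphisms in $\mathfrak W(X)$ that are both bounded and automatic. Permutational wreath product: for a group $G$ and a finite set $Y$, $G\wr\mathrm{Sym}(Y)=G^Y\rtimes\mathrm{Sym}(Y)$, with multiplication $(\alpha_y)_{y}\sigma\cdot(\beta_y)_y\tau=(\alpha_y\beta_{\sigma(y)})_y\,\sigma\tau$ (products of permutations read left to right). Mother group: let $Y$ be a finite set with a distinguished element $o\in Y$ and put $\overline Y=Y\setminus\{o\}$. Let $A=\mathrm{Sym}(Y)$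 and $B=A\wr\mathrm{Sym}(\overline Y)=A^{\overline Y}\rtimes\mathrm{Sym}(\overline Y)$. Embed $A$ in $\mathfrak W(Y)$ by letting $a\in A$ act as $a(yw)=a(y)w$ for $y\in Y$, $w\in Y^*$. Embed $B$ in $\mathfrak W(Y)$ by letting $b=(b_y)_{y\in\overline Y}\,\sigma$ (with $b_y\in A$, $\sigma\in\mathrm{Sym}(\overline Y)$) act recursively as $b(ow)=o\,b(w)$ and $b(yw)=\sigma(y)\,b_y(w)$ for $y\in\overline Y$, $w\in Y^*$, where $b_y\in A$ acts on $Y^*$ as just described. The Mother group $\mathfrak M(Y)=\langle A,B\rangle$ is the subgroup of $\mathfrak W(Y)$ generated by the finite groups $A$ and $B$. Up to isomorphism it does not depend on the choice of $o$. Here it is used with $Y=X^N$, the set of words of length $N$ over $X$. *)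

theory Defs
  imports "HOL-Algebra.Generated_Groups" "HOL-Combinatorics.Permutations" "HOL-Library.NList"
begin

text \<open>
  Alphabets are sets, not types, because the alphabet \<open>nlists N X\<close> of words of
  length \<open>N\<close> has to serve as an alphabet in its own right. Permutations of \<open>Y\<close> and
  automorphisms of the tree over \<open>X\<close> are total functions that are the identity
  outside \<open>Y\<close> and outside \<open>lists X\<close>, respectively, so that equality of functions is equality
  of permutations or automorphisms. All products read left to right: in \<open>\<alpha>\<beta>\<close> the
  factor \<open>\<alpha>\<close> acts first.
\<close>

definition Sym :: "'y set \<Rightarrow> ('y \<Rightarrow> 'y) monoid" where
  "Sym Y = \<lparr>carrier = {\<sigma>. \<sigma> permutes Y}, monoid.mult = (\<lambda>\<sigma> \<tau>. \<tau> \<circ> \<sigma>), monoid.one = id\<rparr>"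

lemma group_Sym: "group (Sym Y)"
proof (rule groupI)
  fix \<sigma> assume "\<sigma> \<in> carrier (Sym Y)"
  then show "\<exists>\<tau>\<in>carrier (Sym Y). \<tau> \<otimes>\<^bsub>Sym Y\<^esub> \<sigma> = \<one>\<^bsub>Sym Y\<^esub>"
    by (intro bexI[of _ "inv_into UNIV \<sigma>"])
       (auto simp: Sym_def permutes_inv permutes_inv_o)
qed (auto simp: Sym_def permutes_id permutes_compose o_assoc)


subsection \<open>The rooted tree and its automorphisms\<close>

definition tree_edges :: "'a set \<Rightarrow> 'a list set set" where
  "tree_edges X = {{w, w @ [x]} | w x. w \<in> lists X \<and> x \<in> X}"

definition is_tree_aut :: "'a set \<Rightarrow> ('a list \<Rightarrow> 'a list) \<Rightarrow> bool" where
  "is_tree_aut X \<alpha> \<longleftrightarrow> \<alpha> permutes lists X \<and> \<alpha> [] = [] \<and>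
     (\<forall>v\<in>lists X. \<forall>w\<in>lists X. {\<alpha> v, \<alpha> w} \<in> tree_edges X \<longleftrightarrow> {v, w} \<in> tree_edges X)"

definition tree_aut :: "'a set \<Rightarrow> ('a list \<Rightarrow> 'a list) monoid" where
  "tree_aut X = \<lparr>carrier = {\<alpha>. is_tree_aut X \<alpha>}, monoid.mult = (\<lambda>\<alpha> \<beta>. \<beta> \<circ> \<alpha>), monoid.one = id\<rparr>"

lemma is_tree_autD:
  assumes "is_tree_aut X \<alpha>"
  shows "\<alpha> permutes lists X" "\<alpha> [] = []" "w \<in> lists X \<Longrightarrow> \<alpha> w \<in> lists X"
  using assms by (auto simp: is_tree_aut_def permutes_in_image)

lemma is_tree_aut_inv:
  assumes "is_tree_aut X \<alpha>" shows "is_tree_aut X (inv_into UNIV \<alpha>)"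
proof -
  let ?\<beta> = "inv_into UNIV \<alpha>"
  have p: "\<alpha> permutes lists X" using is_tree_autD[OF assms] by blast
  have b: "?\<beta> permutes lists X" using p by (rule permutes_inv)
  have "?\<beta> [] = []" using is_tree_autD(2)[OF assms] permutes_inverses(2)[OF p] by metis
  moreover have "{?\<beta> v, ?\<beta> w} \<in> tree_edges X \<longleftrightarrow> {v, w} \<in> tree_edges X"
    if "v \<in> lists X" "w \<in> lists X" for v w
  proof -
    have "?\<beta> v \<in> lists X" "?\<beta> w \<in> lists X" using that b by (simp_all add: permutes_in_image)
    then have "{\<alpha> (?\<beta> v), \<alpha> (?\<beta> w)} \<in> tree_edges X \<longleftrightarrow> {?\<beta> v, ?\<beta> w} \<in> tree_edges X"
      using assms unfolding is_tree_aut_def by blast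
    then show ?thesis by (simp add: permutes_inverses(1)[OF p])
  qed
  ultimately show ?thesis using b by (simp add: is_tree_aut_def)
qed

lemma group_tree_aut: "group (tree_aut X)"
proof (rule groupI)
  fix \<alpha> assume "\<alpha> \<in> carrier (tree_aut X)"
  then have a: "is_tree_aut X \<alpha>" by (simp add: tree_aut_def)
  show "\<exists>\<beta>\<in>carrier (tree_aut X). \<beta> \<otimes>\<^bsub>tree_aut X\<^esub> \<alpha> = \<one>\<^bsub>tree_aut X\<^esub>"
    using is_tree_aut_inv[OF a] is_tree_autD(1)[OF a]
    by (intro bexI[of _ "inv_into UNIV \<alpha>"]) (auto simp: tree_aut_def permutes_inv_o)
qed (auto simp: tree_aut_def is_tree_aut_def permutes_id permutes_compose o_assoc permutes_in_image)

lemma tree_edges_iff: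
  "{v, w} \<in> tree_edges X \<longleftrightarrow>
     (\<exists>x\<in>X. v \<in> lists X \<and> w = v @ [x]) \<or> (\<exists>x\<in>X. w \<in> lists X \<and> v = w @ [x])"
  unfolding tree_edges_def by (auto simp: doubleton_eq_iff)

lemma is_tree_aut_snoc:
  assumes "is_tree_aut X \<alpha>" "w \<in> lists X" "x \<in> X"
  shows "\<exists>y\<in>X. \<alpha> (w @ [x]) = \<alpha> w @ [y]"
  using assms(2,3)
proof (induction w arbitrary: x rule: rev_induct)
  case (snoc z w)
  note D = is_tree_autD[OF assms(1)]
  have e: "{\<alpha> (w @ [z]), \<alpha> ((w @ [z]) @ [x])} \<in> tree_edges X"
    using assms(1) snoc.prems unfolding is_tree_aut_def by (auto simp: tree_edges_iff)
  obtain y where y: "\<alpha> (w @ [z]) = \<alpha> w @ [y]" using snoc by auto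
  have "\<alpha> ((w @ [z]) @ [x]) \<noteq> \<alpha> w"
    using permutes_inj[OF D(1)] by (auto dest!: injD)
  with e y show ?case by (auto simp: tree_edges_iff)
next
  case Nil
  have "{[], [x]} \<in> tree_edges X" "[x] \<in> lists X" using Nil by (auto simp: tree_edges_iff)
  then have "{\<alpha> [], \<alpha> [x]} \<in> tree_edges X"
    using assms(1) unfolding is_tree_aut_def by blast
  then show ?case using is_tree_autD(2)[OF assms(1)] by (auto simp: tree_edges_iff)
qed

lemma is_tree_aut_append:
  assumes "is_tree_aut X \<alpha>" "w \<in> lists X" "w' \<in> lists X"
  shows "\<exists>u. \<alpha> (w @ w') = \<alpha> w @ u"
  using assms(3)
proof (induction w' rule: rev_induct)
  case (snoc x w')
  with is_tree_aut_snoc[OF assms(1), of "w @ w'" x] assms(2) show ?case by auto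
qed simp

lemma is_tree_aut_length:
  assumes "is_tree_aut X \<alpha>" shows "length (\<alpha> w) = length w"
proof (cases "w \<in> lists X")
  case True
  then show ?thesis
  proof (induction w rule: rev_induct)
    case (snoc x w)
    with is_tree_aut_snoc[OF assms, of w x] show ?case by auto
  qed (simp add: is_tree_autD(2)[OF assms])
next
  case False
  then show ?thesis using permutes_not_in[OF is_tree_autD(1)[OF assms]] by metis
qed


subsection \<open>States, bounded automatic automorphisms\<close>

definition state :: "'a set \<Rightarrow> ('a list \<Rightarrow> 'a list) \<Rightarrow> 'a list \<Rightarrow> 'a list \<Rightarrow> 'a list" where
  "state X \<alpha> w = restrict_id (\<lambda>w'. drop (length w) (\<alpha> (w @ w'))) (lists X)"

lemma state_append:
  assumes "is_tree_aut X \<alpha>" "w \<in> lists X" "w' \<in> lists X"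
  shows "\<alpha> (w @ w') = \<alpha> w @ state X \<alpha> w w'"
  using is_tree_aut_append[OF assms] is_tree_aut_length[OF assms(1), of w] assms(3)
  by (auto simp: state_def)

lemma state_unique:
  assumes "is_tree_aut X \<alpha>" "w \<in> lists X" "is_tree_aut X \<beta>"
    and "\<And>w'. w' \<in> lists X \<Longrightarrow> \<alpha> (w @ w') = \<alpha> w @ \<beta> w'"
  shows "\<beta> = state X \<alpha> w"
proof
  fix w'
  show "\<beta> w' = state X \<alpha> w w'"
  proof (cases "w' \<in> lists X")
    case True
    then show ?thesis using assms(4)[OF True] state_append[OF assms(1,2) True] by simp
  next
    case False
    then show ?thesis using permutes_not_in[OF is_tree_autD(1)[OF assms(3)] False]
      unfolding state_def restrict_id_def by simp
  qed
qed

definition automatic :: "'a set \<Rightarrow> ('a list \<Rightarrow> 'a list) \<Rightarrow> bool" where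
  "automatic X \<alpha> \<longleftrightarrow> finite {state X \<alpha> w | w. w \<in> lists X}"

definition bounded_aut :: "'a set \<Rightarrow> ('a list \<Rightarrow> 'a list) \<Rightarrow> bool" where
  "bounded_aut X \<alpha> \<longleftrightarrow> (\<exists>C. \<forall>n. card {w \<in> nlists n X. state X \<alpha> w \<noteq> id} \<le> C)"

definition BA :: "'a set \<Rightarrow> ('a list \<Rightarrow> 'a list) monoid" where
  "BA X = (tree_aut X)
     \<lparr>carrier := {\<alpha> \<in> carrier (tree_aut X). bounded_aut X \<alpha> \<and> automatic X \<alpha>}\<rparr>"


subsection \<open>Permutational wreath products\<close>

definition wreath :: "('g, 'm) monoid_scheme \<Rightarrow> 'y set \<Rightarrow> (('y \<Rightarrow> 'g) \<times> ('y \<Rightarrow> 'y)) monoid" where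
  "wreath G Y =
     \<lparr>carrier = (Y \<rightarrow>\<^sub>E carrier G) \<times> carrier (Sym Y),
      monoid.mult = (\<lambda>(\<alpha>, \<sigma>) (\<beta>, \<tau>). (\<lambda>y\<in>Y. \<alpha> y \<otimes>\<^bsub>G\<^esub> \<beta> (\<sigma> y), \<sigma> \<otimes>\<^bsub>Sym Y\<^esub> \<tau>)),
      monoid.one = (\<lambda>y\<in>Y. \<one>\<^bsub>G\<^esub>, \<one>\<^bsub>Sym Y\<^esub>)\<rparr>"

lemma group_wreath:
  assumes "group G" shows "group (wreath G Y)"
proof (rule groupI)
  interpret group G by fact
  show "p \<otimes>\<^bsub>wreath G Y\<^esub> q \<in> carrier (wreath G Y)"
    if "p \<in> carrier (wreath G Y)" "q \<in> carrier (wreath G Y)" for p q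
    using that
    by (auto simp: wreath_def Sym_def permutes_compose permutes_in_image
             intro!: m_closed elim!: PiE_mem)
  show "p \<otimes>\<^bsub>wreath G Y\<^esub> q \<otimes>\<^bsub>wreath G Y\<^esub> r = p \<otimes>\<^bsub>wreath G Y\<^esub> (q \<otimes>\<^bsub>wreath G Y\<^esub> r)"
    if "p \<in> carrier (wreath G Y)" "q \<in> carrier (wreath G Y)" "r \<in> carrier (wreath G Y)"
    for p q r
  proof -
    obtain \<alpha> \<sigma> \<beta> \<tau> \<gamma> \<rho> where e: "p = (\<alpha>, \<sigma>)" "q = (\<beta>, \<tau>)" "r = (\<gamma>, \<rho>)"
      by (cases p, cases q, cases r)
    have "\<sigma> y \<in> Y" "\<tau> y \<in> Y" if "y \<in> Y" for y
      using \<open>p \<in> _\<close> \<open>q \<in> _\<close> that by (auto simp: e wreath_def Sym_def permutes_in_image)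
    moreover have "\<alpha> y \<in> carrier G" "\<beta> y \<in> carrier G" "\<gamma> y \<in> carrier G" if "y \<in> Y" for y
      using \<open>p \<in> _\<close> \<open>q \<in> _\<close> \<open>r \<in> _\<close> that by (auto simp: e wreath_def)
    ultimately show ?thesis
      by (simp add: e wreath_def Sym_def o_assoc m_assoc cong: restrict_cong)
  qed
  show "\<one>\<^bsub>wreath G Y\<^esub> \<in> carrier (wreath G Y)"
    by (auto simp: wreath_def Sym_def permutes_id)
  show "\<one>\<^bsub>wreath G Y\<^esub> \<otimes>\<^bsub>wreath G Y\<^esub> p = p" if p: "p \<in> carrier (wreath G Y)" for p
  proof -
    obtain \<alpha> \<sigma> where pe: "p = (\<alpha>, \<sigma>)" by (cases p)
    have a: "\<alpha> \<in> Y \<rightarrow>\<^sub>E carrier G" using p by (auto simp: pe wreath_def)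
    have "\<one>\<^bsub>G\<^esub> \<otimes>\<^bsub>G\<^esub> \<alpha> y = \<alpha> y" if "y \<in> Y" for y
      by (rule l_one[OF PiE_mem[OF a that]])
    then have "(\<lambda>y\<in>Y. \<one>\<^bsub>G\<^esub> \<otimes>\<^bsub>G\<^esub> \<alpha> y) = restrict \<alpha> Y" by (rule restrict_ext)
    also have "\<dots> = \<alpha>" using a by (rule PiE_restrict)
    finally show ?thesis by (simp add: pe wreath_def Sym_def restrict_def cong: if_cong)
  qed
  show "\<exists>q\<in>carrier (wreath G Y). q \<otimes>\<^bsub>wreath G Y\<^esub> p = \<one>\<^bsub>wreath G Y\<^esub>"
    if p: "p \<in> carrier (wreath G Y)" for p
  proof -
    obtain \<alpha> \<sigma> where pe: "p = (\<alpha>, \<sigma>)" by (cases p)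
    have s: "\<sigma> permutes Y" and a: "\<alpha> \<in> Y \<rightarrow>\<^sub>E carrier G"
      using p by (auto simp: pe wreath_def Sym_def)
    let ?s = "inv_into UNIV \<sigma>"
    let ?q = "(\<lambda>y\<in>Y. inv\<^bsub>G\<^esub> \<alpha> (?s y), ?s)"
    have s': "?s permutes Y" using s by (rule permutes_inv)
    have "?s y \<in> Y" if "y \<in> Y" for y using that s' by (simp add: permutes_in_image)
    then have c: "\<alpha> (?s y) \<in> carrier G" if "y \<in> Y" for y using a that by auto
    have "?q \<in> carrier (wreath G Y)" using c s' by (auto simp: wreath_def Sym_def)
    moreover have "?q \<otimes>\<^bsub>wreath G Y\<^esub> p = \<one>\<^bsub>wreath G Y\<^esub>"
      using c s by (simp add: pe wreath_def Sym_def permutes_inv_o cong: restrict_cong)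
    ultimately show ?thesis by blast
  qed
qed


subsection \<open>The Mother group\<close>

fun A_act :: "('y \<Rightarrow> 'y) \<Rightarrow> 'y list \<Rightarrow> 'y list" where
  "A_act a [] = []"
| "A_act a (y # w) = a y # w"

fun B_act :: "'y \<Rightarrow> ('y \<Rightarrow> 'y \<Rightarrow> 'y) \<times> ('y \<Rightarrow> 'y) \<Rightarrow> 'y list \<Rightarrow> 'y list" where
  "B_act e b [] = []"
| "B_act e b (y # w) = (if y = e then e # B_act e b w else snd b y # A_act (fst b y) w)"

text \<open>The distinguished letter is called \<open>e\<close>, since \<open>o\<close> is reserved for composition.\<close>

definition mother_A :: "'y set \<Rightarrow> ('y list \<Rightarrow> 'y list) set" where
  "mother_A Y = {restrict_id (A_act a) (lists Y) | a. a \<in> carrier (Sym Y)}"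

definition mother_B :: "'y set \<Rightarrow> 'y \<Rightarrow> ('y list \<Rightarrow> 'y list) set" where
  "mother_B Y e = {restrict_id (B_act e b) (lists Y) | b. b \<in> carrier (wreath (Sym Y) (Y - {e}))}"

lemma is_tree_autI:
  assumes p: "f permutes lists X" and nil: "f [] = []"
    and step: "\<And>w x. w \<in> lists X \<Longrightarrow> x \<in> X \<Longrightarrow> \<exists>y\<in>X. f (w @ [x]) = f w @ [y]"
  shows "is_tree_aut X f"
proof -
  have conv: "\<exists>x\<in>X. w = v @ [x]"
    if "v \<in> lists X" "w \<in> lists X" "f w = f v @ [y]" for v w y
  proof (cases w rule: rev_cases)
    case Nil
    with that nil show ?thesis by simp
  next
    case (snoc u x)
    with that have "u \<in> lists X" "x \<in> X" by auto
    with step[of u x] that snoc have "f u = f v" by auto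
    then have "u = v" using permutes_inj[OF p] by (auto dest: injD)
    with snoc \<open>x \<in> X\<close> show ?thesis by blast
  qed
  have L: "f v \<in> lists X \<longleftrightarrow> v \<in> lists X" for v by (rule permutes_in_image[OF p])
  have "{f v, f w} \<in> tree_edges X \<longleftrightarrow> {v, w} \<in> tree_edges X"
    if "v \<in> lists X" "w \<in> lists X" for v w
  proof -
    have "(\<exists>x\<in>X. f w = f v @ [x]) \<longleftrightarrow> (\<exists>x\<in>X. w = v @ [x])"
      if "v \<in> lists X" "w \<in> lists X" for v w
      using step[OF that(1)] conv[OF that] by auto
    from this[of v w] this[of w v] show ?thesis using that by (simp add: tree_edges_iff L)
  qed
  then show ?thesis using p nil by (simp add: is_tree_aut_def)
qed

lemma permutes_restrict_id:
  assumes "\<And>w. w \<in> S \<Longrightarrow> f w \<in> S \<and> g w \<in> S \<and> g (f w) = w \<and> f (g w) = w"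
  shows "restrict_id f S permutes S"
proof (rule bij_imp_permutes)
  show "bij_betw (restrict_id f S) S S"
    using assms by (intro bij_betw_byWitness[where f' = g]) auto
qed simp

lemma A_act_lists: "a permutes Y \<Longrightarrow> w \<in> lists Y \<Longrightarrow> A_act a w \<in> lists Y"
  by (cases w) (auto simp: permutes_in_image)

lemma A_act_inverse: "a permutes Y \<Longrightarrow> A_act (inv_into UNIV a) (A_act a w) = w"
  "a permutes Y \<Longrightarrow> A_act a (A_act (inv_into UNIV a) w) = w"
  by (cases w; simp add: permutes_inverses)+

lemma A_act_snoc: "a permutes Y \<Longrightarrow> x \<in> Y \<Longrightarrow> \<exists>y\<in>Y. A_act a (w @ [x]) = A_act a w @ [y]"
  by (cases w) (auto simp: permutes_in_image)

lemma mother_A_tree_aut: "mother_A Y \<subseteq> carrier (tree_aut Y)"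
proof -
  have "is_tree_aut Y (restrict_id (A_act a) (lists Y))" if a: "a permutes Y" for a
  proof (rule is_tree_autI)
    show "restrict_id (A_act a) (lists Y) permutes lists Y"
      using a A_act_lists[OF permutes_inv[OF a]] A_act_lists[OF a]
      by (intro permutes_restrict_id[where g = "A_act (inv_into UNIV a)"])
         (auto simp: A_act_inverse)
  qed (use A_act_snoc[OF a] in \<open>auto simp: restrict_id_def\<close>)
  then show ?thesis by (auto simp: mother_A_def tree_aut_def Sym_def)
qed

lemma B_act_lists:
  assumes "e \<in> Y" "\<sigma> permutes Y - {e}" "\<And>y. y \<in> Y - {e} \<Longrightarrow> b y permutes Y"
  shows "w \<in> lists Y \<Longrightarrow> B_act e (b, \<sigma>) w \<in> lists Y"
proof (induction w)
  case (Cons y w)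
  have "\<sigma> y \<in> Y" if "y \<noteq> e"
    using that Cons.prems permutes_in_image[OF assms(2), of y] by auto
  then show ?case using Cons assms(1) A_act_lists[OF assms(3)[of y], of w] by auto
qed simp

lemma B_act_inverse:
  assumes "\<sigma> permutes Y - {e}" "\<And>y. y \<in> Y - {e} \<Longrightarrow> b y permutes Y"
    and "\<tau> permutes Y - {e}" "\<And>y. \<tau> (\<sigma> y) = y"
    and "\<And>y. y \<in> Y - {e} \<Longrightarrow> c (\<sigma> y) = inv_into UNIV (b y)"
  shows "w \<in> lists Y \<Longrightarrow> B_act e (c, \<tau>) (B_act e (b, \<sigma>) w) = w"
proof (induction w)
  case (Cons y w)
  show ?case
  proof (cases "y = e")
    case True
    with Cons show ?thesis by simp
  next
    case False
    with Cons.prems have y: "y \<in> Y - {e}" by auto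
    then have "\<sigma> y \<noteq> e" using permutes_in_image[OF assms(1), of y] by auto
    then show ?thesis using False assms(4,5) y A_act_inverse(1)[OF assms(2)[OF y]] by simp
  qed
qed simp

lemma B_act_snoc:
  assumes "e \<in> Y" "\<sigma> permutes Y - {e}" "\<And>y. y \<in> Y - {e} \<Longrightarrow> b y permutes Y" "x \<in> Y"
  shows "w \<in> lists Y \<Longrightarrow> \<exists>y\<in>Y. B_act e (b, \<sigma>) (w @ [x]) = B_act e (b, \<sigma>) w @ [y]"
proof (induction w)
  case Nil
  show ?case using permutes_in_image[OF assms(2), of x] assms(1,4) by auto
next
  case (Cons y w)
  then show ?case using A_act_snoc[OF assms(3)[of y] assms(4), of w] by auto
qed

lemma mother_B_tree_aut:
  assumes e: "e \<in> Y" shows "mother_B Y e \<subseteq> carrier (tree_aut Y)"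
proof -
  have "is_tree_aut Y (restrict_id (B_act e (b, \<sigma>)) (lists Y))"
    if s: "\<sigma> permutes Y - {e}" and b: "\<And>y. y \<in> Y - {e} \<Longrightarrow> b y permutes Y" for b \<sigma>
  proof (rule is_tree_autI)
    let ?s = "inv_into UNIV \<sigma>"
    let ?b = "\<lambda>y. inv_into UNIV (b (?s y))"
    have s': "?s permutes Y - {e}" using s by (rule permutes_inv)
    have b'': "b (?s y) permutes Y" if "y \<in> Y - {e}" for y
      using b permutes_in_image[OF s', of y] that by blast
    have b': "?b y permutes Y" if "y \<in> Y - {e}" for y
      using permutes_inv[OF b''[OF that]] .
    have 1: "B_act e (?b, ?s) (B_act e (b, \<sigma>) w) = w" if "w \<in> lists Y" for w
      by (rule B_act_inverse[OF s b s' _ _ that]) (simp_all add: permutes_inverses[OF s])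
    have 2: "B_act e (b, \<sigma>) (B_act e (?b, ?s) w) = w" if "w \<in> lists Y" for w
      by (rule B_act_inverse[OF s' b' s _ _ that])
         (simp_all add: permutes_inverses[OF s] permutes_inv_inv[OF b''])
    show "restrict_id (B_act e (b, \<sigma>)) (lists Y) permutes lists Y"
    proof (rule permutes_restrict_id[where g = "B_act e (?b, ?s)"], intro conjI)
      fix w assume w: "w \<in> lists Y"
      show "B_act e (b, \<sigma>) w \<in> lists Y" by (rule B_act_lists[OF e s b w])
      show "B_act e (?b, ?s) w \<in> lists Y" by (rule B_act_lists[OF e s' b' w])
    qed (fact 1, fact 2)
  qed (use B_act_snoc[OF e s b] in \<open>auto simp: restrict_id_def\<close>)
  then show ?thesis by (auto simp: mother_B_def tree_aut_def wreath_def Sym_def PiE_iff)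
qed

definition mother_group :: "'y set \<Rightarrow> 'y \<Rightarrow> ('y list \<Rightarrow> 'y list) monoid" where
  "mother_group Y e = (tree_aut Y)
     \<lparr>carrier := generate (tree_aut Y) (mother_A Y \<union> mother_B Y e)\<rparr>"

lemma group_mother_group:
  assumes "e \<in> Y" shows "group (mother_group Y e)"
proof -
  interpret group "tree_aut Y" by (rule group_tree_aut)
  show ?thesis
    using mother_A_tree_aut[of Y] mother_B_tree_aut[OF assms]
    unfolding mother_group_def by (intro subgroup.subgroup_is_group generate_is_subgroup group_tree_aut) blast
qed

end

theory Submission
  imports Defs
begin

text \<open>
  Only finitely many states occur among the generators, and boundedness leaves, below a deep
  enough vertex, at most one path along which the states are not finitary. Hence for a
  suitable \<open>n\<close> each state \<open>\<alpha>\<close> of a generator at a word of length \<open>2n\<close> either moves only the first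
  \<open>n\<close> letters (it is rooted) or satisfies \<open>\<alpha>\<^sub>v = \<alpha>\<close> for one word \<open>v\<close> of length \<open>n\<close> and
  has rooted states at all other words of that length (it is directed along \<open>v\<close>).

  Over the alphabet of words of length \<open>N = 2n\<close>, such an \<open>\<alpha>\<close> is directed along the letter \<open>vv\<close>.
  The tree automorphism \<open>z1 z2 z3 \<dots> \<mapsto> \<tau>\<^sub>e(z1) \<tau>\<^bsub>z1\<^esub>(z2) \<tau>\<^bsub>z2\<^esub>(z3) \<dots>\<close>, where \<open>\<tau>\<^sub>z\<close>
  exchanges \<open>vv\<close> and \<open>e\<close> if \<open>z = uv\<close>, sends all the sequences \<open>(vv)(vv)(vv)\<dots>\<close> to sequences
  ending in \<open>e e e \<dots>\<close>, and conjugation by it takes the rooted and the directed automorphisms into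
  the Mother group. The states at the words of length \<open>N\<close>, conjugated in this way, and the
  permutation of these words are the coordinates of the embedding into the wreath product.
\<close>


subsection \<open>States\<close>

text \<open>As simplification rules, the facts on \<open>nlists\<close> below loop together with \<open>nlists_iff\<close>.\<close>

declare in_lists_conv_set [simp del]
  nlistsE_length [simp del] nlistsE_set [simp del]
  nlists_appendE [rule del]

lemma nlists_iff: "w \<in> nlists n X \<longleftrightarrow> w \<in> lists X \<and> length w = n"
  unfolding nlists_def by (simp add: in_lists_conv_set subset_code(1) conj_commute)

lemma nlists_lists: "w \<in> nlists n X \<Longrightarrow> w \<in> lists X"
  by (simp add: nlists_iff)

lemma finite_nlists: "finite X \<Longrightarrow> finite (nlists n X)"
  using finite_lists_length_eq[of X n] by (simp add: nlists_def conj_commute)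

lemma append_nlists: "u \<in> nlists m X \<Longrightarrow> v \<in> nlists n X \<Longrightarrow> u @ v \<in> nlists (m + n) X"
  by (simp add: nlists_iff)

lemma nlists_add_split:
  assumes "w \<in> nlists (m + n) X"
  obtains u v where "u \<in> nlists m X" "v \<in> nlists n X" "w = u @ v"
proof (rule that[of "take m w" "drop m w"])
  have "take m w \<in> lists X \<and> drop m w \<in> lists X"
    using assms append_in_lists_conv[of "take m w" "drop m w" X] by (simp add: nlists_iff)
  then show "take m w \<in> nlists m X" "drop m w \<in> nlists n X"
    using assms by (simp_all add: nlists_iff)
qed simp

lemma is_tree_aut_id: "is_tree_aut X id"
  by (simp add: is_tree_aut_def permutes_id)

lemma is_tree_aut_comp: "is_tree_aut X \<alpha> \<Longrightarrow> is_tree_aut X \<beta> \<Longrightarrow> is_tree_aut X (\<beta> \<circ> \<alpha>)"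
  using monoid.m_closed[OF group.is_monoid[OF group_tree_aut], of \<alpha> X \<beta>]
  by (simp add: tree_aut_def)

lemma is_tree_aut_eqI:
  assumes "is_tree_aut X \<alpha>" "is_tree_aut X \<beta>" "\<And>w. w \<in> lists X \<Longrightarrow> \<alpha> w = \<beta> w"
  shows "\<alpha> = \<beta>"
proof
  fix w show "\<alpha> w = \<beta> w"
    using assms(3) permutes_not_in[OF is_tree_autD(1)[OF assms(1)], of w]
      permutes_not_in[OF is_tree_autD(1)[OF assms(2)], of w]
    by (cases "w \<in> lists X") auto
qed

lemma is_tree_aut_inverses:
  assumes "is_tree_aut X \<alpha>"
  shows "inv_into UNIV \<alpha> (\<alpha> w) = w" "\<alpha> (inv_into UNIV \<alpha> w) = w"
    "inv_into UNIV (inv_into UNIV \<alpha>) = \<alpha>"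
  using permutes_inverses[OF is_tree_autD(1)[OF assms]]
    permutes_inv_inv[OF is_tree_autD(1)[OF assms]] by auto

lemma is_tree_aut_nlists:
  assumes "is_tree_aut X \<alpha>" "w \<in> nlists n X" shows "\<alpha> w \<in> nlists n X"
  using assms(2) is_tree_autD(3)[OF assms(1)] by (simp add: nlists_iff is_tree_aut_length[OF assms(1)])

lemma restrict_id_nlists_permutes:
  assumes "is_tree_aut X \<alpha>"
  shows "restrict_id \<alpha> (nlists n X) permutes nlists n X"
  using is_tree_aut_nlists[OF assms] is_tree_aut_nlists[OF is_tree_aut_inv[OF assms]]
  by (intro permutes_restrict_id[where g = "inv_into UNIV \<alpha>"])
    (simp add: is_tree_aut_inverses[OF assms])

lemma state_lists:
  assumes "is_tree_aut X \<alpha>" "w \<in> lists X" "u \<in> lists X"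
  shows "state X \<alpha> w u \<in> lists X"
proof -
  have "\<alpha> (w @ u) \<in> lists X" using assms is_tree_autD(3) append_in_lists_conv by metis
  then show ?thesis by (simp add: state_append[OF assms] append_in_lists_conv)
qed

text \<open>Apply the inverse to \<open>\<alpha> (w @ u)\<close>. The statement is about words
  because a state is not yet known to be a permutation; the inverse found here proves that.\<close>

lemma state_inverse:
  assumes "is_tree_aut X \<alpha>" "w \<in> lists X" "u \<in> lists X"
  shows "state X (inv_into UNIV \<alpha>) (\<alpha> w) (state X \<alpha> w u) = u"
proof -
  have "w @ u = inv_into UNIV \<alpha> (\<alpha> w @ state X \<alpha> w u)"
    by (simp add: state_append[OF assms, symmetric] is_tree_aut_inverses[OF assms(1)])
  also have "\<dots> = w @ state X (inv_into UNIV \<alpha>) (\<alpha> w) (state X \<alpha> w u)"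
    by (subst state_append[OF is_tree_aut_inv[OF assms(1)]])
      (use assms state_lists[OF assms] is_tree_autD(3)[OF assms(1,2)] in
        \<open>simp_all add: is_tree_aut_inverses[OF assms(1)]\<close>)
  finally show ?thesis by simp
qed

lemma is_tree_aut_state:
  assumes "is_tree_aut X \<alpha>" "w \<in> lists X"
  shows "is_tree_aut X (state X \<alpha> w)"
proof (rule is_tree_autI)
  let ?\<beta> = "inv_into UNIV \<alpha>"
  note b = is_tree_aut_inv[OF assms(1)]
  note aw = is_tree_autD(3)[OF assms]
  have "restrict_id (state X \<alpha> w) (lists X) permutes lists X"
    using state_lists[OF assms] state_lists[OF b aw] state_inverse[OF assms]
      state_inverse[OF b aw]
    by (intro permutes_restrict_id[where g = "state X ?\<beta> (\<alpha> w)"])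
      (simp add: is_tree_aut_inverses[OF assms(1)])
  moreover have "restrict_id (state X \<alpha> w) (lists X) = state X \<alpha> w"
    by (auto simp: state_def restrict_id_def)
  ultimately show "state X \<alpha> w permutes lists X" by simp
  show "state X \<alpha> w [] = []" using is_tree_aut_length[OF assms(1)] by (simp add: state_def)
  fix u x assume u: "u \<in> lists X" and x: "x \<in> X"
  have "w @ u \<in> lists X" "u @ [x] \<in> lists X" using assms(2) u x by auto
  then show "\<exists>y\<in>X. state X \<alpha> w (u @ [x]) = state X \<alpha> w u @ [y]"
    using is_tree_aut_snoc[OF assms(1) _ x, of "w @ u"] state_append[OF assms u]
      state_append[OF assms, of "u @ [x]"] by auto
qed

lemma state_id: "state X id w = id"
  by (auto simp: state_def restrict_id_def)

lemma state_Nil: "is_tree_aut X \<alpha> \<Longrightarrow> state X \<alpha> [] = \<alpha>"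
  by (rule state_unique[symmetric]) (auto simp: is_tree_autD)

lemma state_state:
  assumes "is_tree_aut X \<alpha>" "w \<in> lists X" "u \<in> lists X"
  shows "state X (state X \<alpha> w) u = state X \<alpha> (w @ u)"
proof (rule state_unique[OF assms(1)])
  note s = is_tree_aut_state[OF assms(1,2)]
  show wu: "w @ u \<in> lists X" using assms by simp
  show "is_tree_aut X (state X (state X \<alpha> w) u)" by (rule is_tree_aut_state[OF s assms(3)])
  fix v assume v: "v \<in> lists X"
  have "u @ v \<in> lists X" using assms(3) v by simp
  then show "\<alpha> ((w @ u) @ v) = \<alpha> (w @ u) @ state X (state X \<alpha> w) u v"
    using state_append[OF assms(1,2), of "u @ v"] state_append[OF assms]
      state_append[OF s assms(3) v] by simp
qed

lemma state_comp:
  assumes "is_tree_aut X \<alpha>" "is_tree_aut X \<beta>" "w \<in> lists X"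
  shows "state X (\<beta> \<circ> \<alpha>) w = state X \<beta> (\<alpha> w) \<circ> state X \<alpha> w"
proof (rule state_unique[symmetric])
  note aw = is_tree_autD(3)[OF assms(1,3)]
  show "is_tree_aut X (state X \<beta> (\<alpha> w) \<circ> state X \<alpha> w)"
    by (intro is_tree_aut_comp is_tree_aut_state assms aw)
  fix u assume u: "u \<in> lists X"
  show "(\<beta> \<circ> \<alpha>) (w @ u) = (\<beta> \<circ> \<alpha>) w @ (state X \<beta> (\<alpha> w) \<circ> state X \<alpha> w) u"
    using state_append[OF assms(1,3) u] state_append[OF assms(2) aw state_lists[OF assms(1,3) u]]
    by simp
qed (use assms is_tree_aut_comp in auto)

lemma state_inv:
  assumes "is_tree_aut X \<alpha>" "w \<in> lists X"
  shows "state X (inv_into UNIV \<alpha>) w = inv_into UNIV (state X \<alpha> (inv_into UNIV \<alpha> w))"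
proof -
  let ?v = "inv_into UNIV \<alpha> w"
  note b = is_tree_aut_inv[OF assms(1)]
  have v: "?v \<in> lists X" by (rule is_tree_autD(3)[OF b assms(2)])
  note s = is_tree_aut_state[OF assms(1) v]
  have "state X \<alpha> ?v \<circ> state X (inv_into UNIV \<alpha>) w = id"
    using state_comp[OF b assms(1,2)] permutes_inv_o(1)[OF is_tree_autD(1)[OF assms(1)]]
    by (simp add: state_id)
  then have "inv_into UNIV (state X \<alpha> ?v) \<circ> (state X \<alpha> ?v \<circ> state X (inv_into UNIV \<alpha>) w)
      = inv_into UNIV (state X \<alpha> ?v)" by simp
  then show ?thesis
    by (simp add: o_assoc permutes_inv_o(2)[OF is_tree_autD(1)[OF s]])
qed

text \<open>By \<open>state_inv\<close> the states of the inverse are the inverted states of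
  \<open>\<alpha>\<close> at vertices moved within their level, so finiteness and the bound
  \<open>C\<close> carry over.\<close>

lemma carrier_BA_inv:
  assumes "finite X" "\<alpha> \<in> carrier (BA X)"
  shows "inv_into UNIV \<alpha> \<in> carrier (BA X)"
proof -
  let ?\<beta> = "inv_into UNIV \<alpha>"
  have a: "is_tree_aut X \<alpha>" and bd: "bounded_aut X \<alpha>" and at: "automatic X \<alpha>"
    using assms(2) by (auto simp: BA_def tree_aut_def)
  note b = is_tree_aut_inv[OF a]
  have "{state X ?\<beta> w | w. w \<in> lists X} \<subseteq> inv_into UNIV ` {state X \<alpha> w | w. w \<in> lists X}"
    using state_inv[OF a] is_tree_autD(3)[OF b] by blast
  then have "automatic X ?\<beta>"
    using at finite_subset unfolding automatic_def by blast
  moreover have "bounded_aut X ?\<beta>"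
  proof -
    obtain C where C: "card {w \<in> nlists n X. state X \<alpha> w \<noteq> id} \<le> C" for n
      using bd unfolding bounded_aut_def by blast
    have "card {w \<in> nlists n X. state X ?\<beta> w \<noteq> id} \<le> C" for n
    proof -
      have "{w \<in> nlists n X. state X ?\<beta> w \<noteq> id} \<subseteq> \<alpha> ` {w \<in> nlists n X. state X \<alpha> w \<noteq> id}"
      proof clarify
        fix w assume w: "w \<in> nlists n X" "state X ?\<beta> w \<noteq> id"
        then have "?\<beta> w \<in> nlists n X" by (simp add: is_tree_aut_nlists[OF b])
        moreover have "state X \<alpha> (?\<beta> w) \<noteq> id"
          using w state_inv[OF a, of w] by (auto simp: nlists_iff inv_id)
        ultimately show "w \<in> \<alpha> ` {w \<in> nlists n X. state X \<alpha> w \<noteq> id}"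
          by (intro image_eqI[of _ _ "?\<beta> w"]) (simp_all add: is_tree_aut_inverses[OF a])
      qed
      moreover have "finite {w \<in> nlists n X. state X \<alpha> w \<noteq> id}"
        using assms(1) by (simp add: finite_nlists)
      ultimately have "card {w \<in> nlists n X. state X ?\<beta> w \<noteq> id}
          \<le> card {w \<in> nlists n X. state X \<alpha> w \<noteq> id}"
        by (meson surj_card_le)
      then show ?thesis using C[of n] by linarith
    qed
    then show ?thesis unfolding bounded_aut_def by blast
  qed
  ultimately show ?thesis using b by (simp add: BA_def tree_aut_def)
qed


subsection \<open>Words as letters\<close>

text \<open>The automorphism \<open>\<alpha>\<close> itself, read on words whose letters are words
  over \<open>X\<close> (see \<open>concat_block_act\<close>). The common length of the letters
  enters only in \<open>block_aut\<close>.\<close>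

primrec block_act :: "'a set \<Rightarrow> ('a list \<Rightarrow> 'a list) \<Rightarrow> 'a list list \<Rightarrow> 'a list list" where
  "block_act X \<alpha> [] = []"
| "block_act X \<alpha> (z # r) = \<alpha> z # block_act X (state X \<alpha> z) r"

lemma block_act_id: "block_act X id r = r"
proof (induction r)
  case (Cons z r)
  show ?case unfolding block_act.simps state_id Cons.IH by simp
qed simp

lemma block_act_lists:
  assumes "is_tree_aut X \<alpha>" "r \<in> lists (nlists N X)"
  shows "block_act X \<alpha> r \<in> lists (nlists N X)"
  using assms(2,1)
  by (induction r arbitrary: \<alpha>) (simp_all add: is_tree_aut_nlists is_tree_aut_state nlists_lists)

lemma block_act_comp:
  assumes "is_tree_aut X \<alpha>" "is_tree_aut X \<beta>" "r \<in> lists (nlists N X)"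
  shows "block_act X (\<beta> \<circ> \<alpha>) r = block_act X \<beta> (block_act X \<alpha> r)"
  using assms(3,1,2)
proof (induction r arbitrary: \<alpha> \<beta>)
  case (Cons z r)
  have z: "z \<in> lists X" using Cons.hyps by (simp add: nlists_iff)
  show ?case
    unfolding block_act.simps state_comp[OF Cons.prems z]
      Cons.IH[OF is_tree_aut_state[OF Cons.prems(1) z]
        is_tree_aut_state[OF Cons.prems(2) is_tree_autD(3)[OF Cons.prems(1) z]]]
    by simp
qed simp

lemma concat_block_act:
  assumes "is_tree_aut X \<alpha>" "r \<in> lists (nlists N X)"
  shows "concat (block_act X \<alpha> r) = \<alpha> (concat r)"
  using assms(2,1)
proof (induction r arbitrary: \<alpha>)
  case (Cons z r)
  have z: "z \<in> lists X" using Cons.hyps by (simp add: nlists_iff)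
  have "concat r \<in> lists X"
    using Cons.hyps(2) by (induction r) (simp_all add: nlists_iff)
  then show ?case
    using Cons.IH[OF is_tree_aut_state[OF Cons.prems z]] state_append[OF Cons.prems z] by simp
qed (simp add: is_tree_autD)

lemma block_act_snoc:
  assumes "is_tree_aut X \<alpha>" "r \<in> lists (nlists N X)" "z \<in> nlists N X"
  shows "\<exists>y\<in>nlists N X. block_act X \<alpha> (r @ [z]) = block_act X \<alpha> r @ [y]"
  using assms(2,1,3)
  by (induction r arbitrary: \<alpha>) (simp_all add: is_tree_aut_nlists is_tree_aut_state nlists_lists)

definition block_aut :: "nat \<Rightarrow> 'a set \<Rightarrow> ('a list \<Rightarrow> 'a list) \<Rightarrow> 'a list list \<Rightarrow> 'a list list" where
  "block_aut N X \<alpha> = restrict_id (block_act X \<alpha>) (lists (nlists N X))"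

lemma is_tree_aut_block_aut:
  assumes a: "is_tree_aut X \<alpha>"
  shows "is_tree_aut (nlists N X) (block_aut N X \<alpha>)"
proof (rule is_tree_autI)
  note p = permutes_inv_o[OF is_tree_autD(1)[OF a]]
  show "block_aut N X \<alpha> permutes lists (nlists N X)"
    unfolding block_aut_def
    using block_act_lists[OF a] block_act_lists[OF is_tree_aut_inv[OF a]]
      block_act_comp[OF a is_tree_aut_inv[OF a]] block_act_comp[OF is_tree_aut_inv[OF a] a]
    by (intro permutes_restrict_id[where g = "block_act X (inv_into UNIV \<alpha>)"])
      (simp add: p block_act_id)
qed (use block_act_snoc[OF a] in \<open>simp_all add: block_aut_def restrict_id_def\<close>)

lemma block_aut_comp:
  assumes "is_tree_aut X \<alpha>" "is_tree_aut X \<beta>"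
  shows "block_aut N X (\<beta> \<circ> \<alpha>) = block_aut N X \<beta> \<circ> block_aut N X \<alpha>"
  using block_act_lists[OF assms(1)] block_act_comp[OF assms]
  by (auto simp: block_aut_def restrict_id_def fun_eq_iff)

text \<open>Concatenation recovers \<open>\<alpha>\<close> on words of length divisible by
  \<open>N\<close>. Any other word is padded to such a length, and automorphisms preserve
  prefixes.\<close>

lemma block_aut_inj:
  assumes "X \<noteq> {}" "N > 0" "is_tree_aut X \<alpha>" "is_tree_aut X \<beta>"
    and eq: "block_aut N X \<alpha> = block_aut N X \<beta>"
  shows "\<alpha> = \<beta>"
proof (rule is_tree_aut_eqI[OF assms(3,4)])
  fix w assume w: "w \<in> lists X"
  have conc: "\<exists>r\<in>lists (nlists N X). concat r = u" if "u \<in> nlists (k * N) X" for u k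
    using that
  proof (induction k arbitrary: u)
    case 0
    then show ?case by (intro bexI[of _ "[]"]) simp_all
  next
    case (Suc k)
    then have "u \<in> nlists (N + k * N) X" by simp
    then obtain v v' where v: "v \<in> nlists N X" "v' \<in> nlists (k * N) X" "u = v @ v'"
      by (rule nlists_add_split)
    with Suc.IH obtain r where "r \<in> lists (nlists N X)" "concat r = v'" by blast
    with v show ?case by (intro bexI[of _ "v # r"]) simp_all
  qed
  obtain x where x: "x \<in> X" using assms(1) by blast
  \<comment> \<open>The padded length \<open>length w * N\<close> is not below
    \<open>length w\<close> because \<open>N > 0\<close>.\<close>
  define p where "p = replicate (length w * N - length w) x"
  have p: "p \<in> lists X" using x by (simp add: p_def in_lists_conv_set)
  have "length (w @ p) = length w * N" using \<open>N > 0\<close> by (simp add: p_def)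
  then have "w @ p \<in> nlists (length w * N) X" using w p by (simp add: nlists_iff)
  then obtain r where r: "r \<in> lists (nlists N X)" "concat r = w @ p" using conc by blast
  have "\<alpha> (w @ p) = \<beta> (w @ p)"
    using concat_block_act[OF assms(3) r(1)] concat_block_act[OF assms(4) r(1)]
      fun_cong[OF eq, of r] r by (simp add: block_aut_def)
  then show "\<alpha> w = \<beta> w"
    using is_tree_aut_append[OF assms(3) w p] is_tree_aut_append[OF assms(4) w p]
      is_tree_aut_length[OF assms(3), of w] is_tree_aut_length[OF assms(4), of w] by auto
qed


subsection \<open>Twisting the tree\<close>

text \<open>Each letter is permuted according to the original letter before it; \<open>c\<close>
  stands in for a letter before the first one.\<close>

fun twist :: "('y \<Rightarrow> 'y \<Rightarrow> 'y) \<Rightarrow> 'y \<Rightarrow> 'y list \<Rightarrow> 'y list" where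
  "twist \<tau> c [] = []"
| "twist \<tau> c (y # w) = \<tau> c y # twist \<tau> y w"

text \<open>Original letters choose the permutations, so decoding runs from the left and passes on
  each recovered letter.\<close>

fun untwist :: "('y \<Rightarrow> 'y \<Rightarrow> 'y) \<Rightarrow> 'y \<Rightarrow> 'y list \<Rightarrow> 'y list" where
  "untwist \<tau> c [] = []"
| "untwist \<tau> c (y # w) = inv_into UNIV (\<tau> c) y # untwist \<tau> (inv_into UNIV (\<tau> c) y) w"

definition twist_aut :: "('y \<Rightarrow> 'y \<Rightarrow> 'y) \<Rightarrow> 'y set \<Rightarrow> 'y \<Rightarrow> 'y list \<Rightarrow> 'y list" where
  "twist_aut \<tau> Y c = restrict_id (twist \<tau> c) (lists Y)"

context
  fixes \<tau> :: "'y \<Rightarrow> 'y \<Rightarrow> 'y" and Y :: "'y set"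
  assumes \<tau>: "\<And>c. c \<in> Y \<Longrightarrow> \<tau> c permutes Y"
begin

lemma \<tau>_in: "c \<in> Y \<Longrightarrow> \<tau> c y \<in> Y \<longleftrightarrow> y \<in> Y" "c \<in> Y \<Longrightarrow> inv_into UNIV (\<tau> c) y \<in> Y \<longleftrightarrow> y \<in> Y"
  using permutes_in_image[OF \<tau>] permutes_in_image[OF permutes_inv[OF \<tau>]] by auto

lemma \<tau>_inv: "c \<in> Y \<Longrightarrow> \<tau> c (inv_into UNIV (\<tau> c) y) = y" "c \<in> Y \<Longrightarrow> inv_into UNIV (\<tau> c) (\<tau> c y) = y"
  using permutes_inverses[OF \<tau>] by auto

lemma twist_untwist:
  assumes "c \<in> Y" "w \<in> lists Y"
  shows "twist \<tau> c w \<in> lists Y" "untwist \<tau> c w \<in> lists Y"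
    "untwist \<tau> c (twist \<tau> c w) = w" "twist \<tau> c (untwist \<tau> c w) = w"
  using assms(2,1) by (induction w arbitrary: c) (simp_all add: \<tau>_in \<tau>_inv)

lemma twist_snoc:
  assumes "c \<in> Y" "w \<in> lists Y" "y \<in> Y"
  shows "\<exists>x\<in>Y. twist \<tau> c (w @ [y]) = twist \<tau> c w @ [x]"
  using assms(2,1) by (induction w arbitrary: c) (simp_all add: \<tau>_in assms(3))

lemma is_tree_aut_twist_aut:
  assumes "c \<in> Y" shows "is_tree_aut Y (twist_aut \<tau> Y c)"
proof (rule is_tree_autI)
  show "twist_aut \<tau> Y c permutes lists Y"
    unfolding twist_aut_def using twist_untwist[OF assms]
    by (intro permutes_restrict_id[where g = "untwist \<tau> c"]) simp
qed (use twist_snoc[OF assms] in \<open>simp_all add: twist_aut_def restrict_id_def\<close>)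

text \<open>The parameter influences only the first letter. This later adjusts the parameters in
  \<open>twist_B_act\<close>.\<close>

lemma twist_change:
  assumes "c \<in> Y"
  shows "twist \<tau> d w = A_act (\<tau> d \<circ> inv_into UNIV (\<tau> c)) (twist \<tau> c w)"
  by (cases w) (simp_all add: \<tau>_inv[OF assms])

text \<open>A new first letter could select another permutation for the second one; the assumption
  on \<open>a\<close> excludes this, so the twisted action again touches the first letter
  only.\<close>

lemma twist_A_act:
  assumes "c \<in> Y" "w \<in> lists Y" "\<And>y. y \<in> Y \<Longrightarrow> \<tau> (a y) = \<tau> y"
  shows "twist \<tau> d (A_act a w) = A_act (\<tau> d \<circ> a \<circ> inv_into UNIV (\<tau> c)) (twist \<tau> c w)"
proof (cases w)
  case (Cons y v)
  have "twist \<tau> (a y) v = twist \<tau> y v"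
    using assms(2,3) Cons by (cases v) auto
  then show ?thesis using Cons by (simp add: \<tau>_inv[OF assms(1)])
qed simp

text \<open>If \<open>\<tau> x\<close> and \<open>\<tau> x'\<close> move \<open>x\<close> and \<open>x'\<close> to \<open>e\<close>, the twist carries an automorphism
  directed along \<open>x x x \<dots>\<close> to one directed along \<open>e e e \<dots>\<close>, that is, to an element of \<open>B\<close>.\<close>

lemma twist_B_act:
  assumes x: "x \<in> Y" "x' \<in> Y" "\<tau> x x = e" "\<tau> x' x' = e"
    and \<pi>: "\<pi> permutes Y" "\<pi> x = x'"
    and a: "\<And>y. y \<in> Y \<Longrightarrow> y \<noteq> x \<Longrightarrow> a y permutes Y"
      "\<And>y z. y \<in> Y \<Longrightarrow> y \<noteq> x \<Longrightarrow> z \<in> Y \<Longrightarrow> \<tau> (a y z) = \<tau> z"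
    and f: "f [] = []" "\<And>w. w \<in> lists Y \<Longrightarrow> f (x # w) = x' # f w"
      "\<And>y w. y \<in> Y \<Longrightarrow> y \<noteq> x \<Longrightarrow> w \<in> lists Y \<Longrightarrow> f (y # w) = \<pi> y # A_act (a y) w"
  obtains b where "b \<in> carrier (wreath (Sym Y) (Y - {e}))"
    "\<And>w. w \<in> lists Y \<Longrightarrow> twist \<tau> x' (f w) = B_act e b (twist \<tau> x w)"
proof
  \<comment> \<open>The letter \<open>e\<close> comes from \<open>x\<close>, which goes to
    \<open>x'\<close> and so back to \<open>e\<close>; hence \<open>\<sigma>\<close> restricts to
    the other letters.\<close>
  define \<sigma> where "\<sigma> = \<tau> x' \<circ> \<pi> \<circ> inv_into UNIV (\<tau> x)"
  \<comment> \<open>The original letter \<open>z\<close> behind \<open>y\<close> selects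
    \<open>\<tau> z\<close> for the next letter, and its image selects
    \<open>\<tau> (\<pi> z)\<close>; \<open>a z\<close> acts in between.\<close>
  define p where "p = (\<lambda>y. let z = inv_into UNIV (\<tau> x) y in \<tau> (\<pi> z) \<circ> a z \<circ> inv_into UNIV (\<tau> z))"
  let ?b = "(restrict p (Y - {e}), \<sigma>)"
  have ex: "inv_into UNIV (\<tau> x) e = x" using \<tau>_inv(2)[OF x(1), of x] x(3) by simp
  have sY: "\<sigma> permutes Y"
    unfolding \<sigma>_def
    by (rule permutes_compose[OF permutes_inv[OF \<tau>[OF x(1)]] permutes_compose[OF \<pi>(1) \<tau>[OF x(2)]], unfolded o_assoc])
  have "\<sigma> e = e" by (simp add: \<sigma>_def ex \<pi> x)
  then have s: "\<sigma> permutes Y - {e}"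
    by (auto intro: permutes_superset[OF sY])
  have "p y permutes Y" if "y \<in> Y - {e}" for y
  proof -
    define z where "z = inv_into UNIV (\<tau> x) y"
    have z: "z \<in> Y" "z \<noteq> x" using that \<tau>_in[OF x(1)] \<tau>_inv(1)[OF x(1), of y] x(3)
      by (auto simp: z_def)
    have "\<pi> z \<in> Y" using z \<pi>(1) by (simp add: permutes_in_image)
    then show ?thesis
      unfolding p_def Let_def z_def[symmetric]
      using permutes_compose[OF permutes_inv[OF \<tau>[OF z(1)]] permutes_compose[OF a(1)[OF z] \<tau>]]
      by (simp add: o_assoc)
  qed
  then show "?b \<in> carrier (wreath (Sym Y) (Y - {e}))"
    using s by (auto simp: wreath_def Sym_def)
  show "twist \<tau> x' (f w) = B_act e ?b (twist \<tau> x w)" if "w \<in> lists Y" for w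
    using that
  proof (induction w)
    case (Cons y w)
    show ?case
    proof (cases "y = x")
      \<comment> \<open>Both sides emit \<open>e\<close> and pass on the parameters \<open>x\<close>
        and \<open>x'\<close>, which are those of the claim again, so the induction hypothesis
        applies.\<close>
      case True
      with Cons show ?thesis by (simp add: f x)
    next
      case False
      have "\<tau> x y \<noteq> e" using False ex \<tau>_inv(2)[OF x(1), of y] by auto
      moreover have "\<tau> x y \<in> Y" using Cons.hyps \<tau>_in[OF x(1)] by simp
      moreover have "twist \<tau> (\<pi> y) (A_act (a y) w) = A_act (p (\<tau> x y)) (twist \<tau> y w)"
        using twist_A_act[OF Cons.hyps(1,2) a(2)[OF Cons.hyps(1) False]]
        by (simp add: p_def \<tau>_inv[OF x(1)])
      ultimately show ?thesis using f(3)[OF Cons.hyps(1) False Cons.hyps(2)]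
        by (simp add: \<sigma>_def \<tau>_inv[OF x(1)])
    qed
  qed (simp add: f)
qed

end


subsection \<open>Rooted and directed automorphisms\<close>

definition rooted :: "'a set \<Rightarrow> nat \<Rightarrow> ('a list \<Rightarrow> 'a list) \<Rightarrow> bool" where
  "rooted X n \<alpha> \<longleftrightarrow> (\<forall>u\<in>nlists n X. state X \<alpha> u = id)"

definition directed :: "'a set \<Rightarrow> nat \<Rightarrow> ('a list \<Rightarrow> 'a list) \<Rightarrow> 'a list \<Rightarrow> bool" where
  "directed X n \<alpha> v \<longleftrightarrow> v \<in> nlists n X \<and> state X \<alpha> v = \<alpha> \<and>
     (\<forall>u\<in>nlists n X. u \<noteq> v \<longrightarrow> rooted X n (state X \<alpha> u))"

lemma rooted_id: "rooted X n id"
  by (simp add: rooted_def state_id)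

lemma rooted_append:
  assumes "is_tree_aut X \<alpha>" "rooted X n \<alpha>" "u \<in> nlists n X" "w \<in> lists X"
  shows "\<alpha> (u @ w) = \<alpha> u @ w" "state X \<alpha> (u @ w) = id"
  using state_append[OF assms(1) nlists_lists[OF assms(3)] assms(4)]
    state_state[OF assms(1) nlists_lists[OF assms(3)] assms(4)] assms(2,3)
  by (auto simp: rooted_def state_id)

lemma rooted_mono:
  assumes "is_tree_aut X \<alpha>" "rooted X m \<alpha>" "m \<le> n"
  shows "rooted X n \<alpha>"
  unfolding rooted_def
proof
  fix u assume "u \<in> nlists n X"
  then have "u \<in> nlists (m + (n - m)) X" using assms(3) by simp
  then obtain v w where "v \<in> nlists m X" "w \<in> nlists (n - m) X" "u = v @ w"
    by (rule nlists_add_split)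
  then show "state X \<alpha> u = id" using rooted_append[OF assms(1,2)] by (simp add: nlists_lists)
qed

lemma rooted_block_act:
  assumes "is_tree_aut X \<alpha>" "rooted X n \<alpha>" "r \<in> lists (nlists (n + n) X)"
  shows "block_act X \<alpha> r = A_act (restrict_id \<alpha> (nlists (n + n) X)) r"
proof (cases r)
  case (Cons z w)
  then have z: "z \<in> nlists (n + n) X" using assms(3) by simp
  then obtain u v where "u \<in> nlists n X" "v \<in> nlists n X" "z = u @ v"
    by (rule nlists_add_split)
  then have s: "state X \<alpha> z = id" using rooted_append[OF assms(1,2)] by (simp add: nlists_lists)
  show ?thesis unfolding Cons block_act.simps s block_act_id using z by simp
qed simp

text \<open>Below depth \<open>n\<close> a rooted automorphism changes nothing. Letters have length
  \<open>n + n\<close> so that a half out of its reach can steer \<open>half_twist\<close>.\<close>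

lemma rooted_drop:
  assumes "is_tree_aut X \<alpha>" "rooted X n \<alpha>" "z \<in> nlists (n + n) X"
  shows "drop n (\<alpha> z) = drop n z"
proof -
  obtain u v where uv: "u \<in> nlists n X" "v \<in> nlists n X" "z = u @ v"
    using assms(3) by (rule nlists_add_split)
  then show ?thesis
    using rooted_append(1)[OF assms(1,2) uv(1)] is_tree_aut_length[OF assms(1), of u]
    by (simp add: nlists_iff)
qed

text \<open>The letters \<open>v @ v\<close>, along which a directed automorphism repeats itself, are determined
  by their second half, which no rooted automorphism changes.\<close>

definition half_twist :: "nat \<Rightarrow> 'a list \<Rightarrow> 'a list \<Rightarrow> 'a list \<Rightarrow> 'a list" where
  "half_twist n e z = Transposition.transpose (drop n z @ drop n z) e"

lemma half_twist_permutes: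
  assumes "e \<in> nlists (n + n) X" "z \<in> nlists (n + n) X"
  shows "half_twist n e z permutes nlists (n + n) X"
proof -
  obtain u v where "u \<in> nlists n X" "v \<in> nlists n X" "z = u @ v"
    using assms(2) by (rule nlists_add_split)
  then have "drop n z @ drop n z \<in> nlists (n + n) X" by (simp add: nlists_iff)
  then show ?thesis unfolding half_twist_def by (intro permutes_swap_id assms(1))
qed

lemma half_twist_double: "v \<in> nlists n X \<Longrightarrow> half_twist n e (v @ v) (v @ v) = e"
  by (simp add: half_twist_def nlists_iff)

section \<open>Conjugation by the twist, into the Mother group\<close>

definition untwisted :: "nat \<Rightarrow> 'a set \<Rightarrow> 'a list \<Rightarrow> ('a list \<Rightarrow> 'a list) \<Rightarrow> 'a list list \<Rightarrow> 'a list list" where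
  "untwisted n X e \<alpha> = twist_aut (half_twist n e) (nlists (n + n) X) e \<circ> block_aut (n + n) X \<alpha> \<circ>
     inv_into UNIV (twist_aut (half_twist n e) (nlists (n + n) X) e)"

context
  fixes n :: nat and X :: "'a set" and e :: "'a list"
  assumes e: "e \<in> nlists (n + n) X"
begin

abbreviation (input) "Z \<equiv> nlists (n + n) X"
abbreviation (input) "\<tau> \<equiv> half_twist n e"
abbreviation (input) "\<delta> \<equiv> twist_aut \<tau> Z e"

lemma \<delta>: "is_tree_aut Z \<delta>"
  by (intro is_tree_aut_twist_aut half_twist_permutes e)

lemma is_tree_aut_untwisted: "is_tree_aut X \<alpha> \<Longrightarrow> is_tree_aut Z (untwisted n X e \<alpha>)"
  unfolding untwisted_def
  by (intro is_tree_aut_comp is_tree_aut_inv is_tree_aut_block_aut \<delta>)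

lemma untwisted_comp:
  assumes "is_tree_aut X \<alpha>" "is_tree_aut X \<beta>"
  shows "untwisted n X e (\<beta> \<circ> \<alpha>) = untwisted n X e \<beta> \<circ> untwisted n X e \<alpha>"
  by (simp add: untwisted_def block_aut_comp[OF assms] fun_eq_iff is_tree_aut_inverses[OF \<delta>])

lemma untwisted_inj:
  assumes "X \<noteq> {}" "n > 0" "is_tree_aut X \<alpha>" "is_tree_aut X \<beta>"
    and "untwisted n X e \<alpha> = untwisted n X e \<beta>"
  shows "\<alpha> = \<beta>"
proof (rule block_aut_inj[OF assms(1) _ assms(3,4)])
  have "\<delta> (block_aut (n + n) X \<alpha> w) = \<delta> (block_aut (n + n) X \<beta> w)" for w
    using fun_cong[OF assms(5), of "\<delta> w"]
    by (simp add: untwisted_def is_tree_aut_inverses[OF \<delta>])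
  then show "block_aut (n + n) X \<alpha> = block_aut (n + n) X \<beta>"
    using permutes_inj[OF is_tree_autD(1)[OF \<delta>]] by (auto dest: injD)
qed (use assms(2) in simp)

text \<open>Every word is a twisted one, so the conjugate can be identified by an intertwining
  relation, without computing the inverse twist.\<close>

lemma untwisted_eqI:
  assumes "is_tree_aut X \<alpha>" "is_tree_aut Z m"
    and "\<And>r. r \<in> lists Z \<Longrightarrow> m (twist \<tau> e r) = twist \<tau> e (block_act X \<alpha> r)"
  shows "untwisted n X e \<alpha> = m"
proof (rule is_tree_aut_eqI[OF is_tree_aut_untwisted[OF assms(1)] assms(2)])
  fix w assume "w \<in> lists Z"
  define r where "r = inv_into UNIV \<delta> w"
  have r: "r \<in> lists Z" "w = \<delta> r"
    using is_tree_autD(3)[OF is_tree_aut_inv[OF \<delta>] \<open>w \<in> lists Z\<close>]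
    by (simp_all add: r_def is_tree_aut_inverses[OF \<delta>])
  then show "untwisted n X e \<alpha> w = m w"
    using assms(3)[OF r(1)] block_act_lists[OF assms(1) r(1)]
    by (simp add: untwisted_def is_tree_aut_inverses[OF \<delta>] block_aut_def)
      (simp add: twist_aut_def)
qed

lemma mother_A_in_mother:
  assumes "a permutes Z"
  shows "restrict_id (A_act a) (lists Z) \<in> carrier (mother_group Z e)"
  using assms unfolding mother_group_def mother_A_def
  by (auto simp: Sym_def intro!: generate.incl)

lemma mother_B_in_mother:
  assumes "b \<in> carrier (wreath (Sym Z) (Z - {e}))"
  shows "restrict_id (B_act e b) (lists Z) \<in> carrier (mother_group Z e)"
proof -
  have "restrict_id (B_act e b) (lists Z) \<in> mother_B Z e"
    using assms unfolding mother_B_def by blast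
  then show ?thesis by (simp add: mother_group_def generate.incl)
qed

lemma mother_tree_aut: "m \<in> carrier (mother_group Z e) \<Longrightarrow> is_tree_aut Z m"
  using group.generate_in_carrier[OF group_tree_aut, of "mother_A Z \<union> mother_B Z e" Z m]
    mother_A_tree_aut[of Z] mother_B_tree_aut[OF e]
  by (simp add: mother_group_def tree_aut_def)

lemma mother_comp:
  assumes "m \<in> carrier (mother_group Z e)" "m' \<in> carrier (mother_group Z e)"
  shows "m' \<circ> m \<in> carrier (mother_group Z e)"
  using monoid.m_closed[OF group.is_monoid[OF group_mother_group[OF e]] assms]
  by (simp add: mother_group_def tree_aut_def)

text \<open>A rooted automorphism keeps the second halves of letters, hence the permutations they
  select, and \<open>twist_A_act\<close> yields an element of \<open>A\<close>.\<close>

lemma untwisted_rooted: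
  assumes "is_tree_aut X \<alpha>" "rooted X n \<alpha>"
  shows "untwisted n X e \<alpha> \<in> carrier (mother_group Z e)"
proof -
  let ?a = "restrict_id \<alpha> Z"
  let ?a' = "\<tau> e \<circ> ?a \<circ> inv_into UNIV (\<tau> e)"
  note \<tau> = half_twist_permutes[OF e]
  have a: "?a permutes Z" by (rule restrict_id_nlists_permutes[OF assms(1)])
  have "?a' permutes Z"
    using permutes_compose[OF permutes_inv[OF \<tau>[OF e]] permutes_compose[OF a \<tau>[OF e]]]
    by (simp add: o_assoc)
  then have m: "restrict_id (A_act ?a') (lists Z) \<in> carrier (mother_group Z e)"
    by (rule mother_A_in_mother)
  have "\<tau> (?a y) = \<tau> y" if "y \<in> Z" for y
    using that rooted_drop[OF assms that] by (simp add: half_twist_def)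
  then have "restrict_id (A_act ?a') (lists Z) (twist \<tau> e r) = twist \<tau> e (block_act X \<alpha> r)"
    if "r \<in> lists Z" for r
    using that twist_A_act[OF \<tau> e that, where a = ?a and d = e] twist_untwist(1)[OF \<tau> e that]
    by (simp add: rooted_block_act[OF assms that])
  then have "untwisted n X e \<alpha> = restrict_id (A_act ?a') (lists Z)"
    by (rule untwisted_eqI[OF assms(1) mother_tree_aut[OF m]])
  with m show ?thesis by simp
qed

text \<open>An element of \<open>B\<close> links the twists with parameters \<open>x\<close> and
  \<open>x'\<close>. The conjugation has parameter \<open>e\<close> on both sides, which costs one
  factor from \<open>A\<close> before and one after.\<close>

lemma untwisted_directed:
  assumes \<alpha>: "is_tree_aut X \<alpha>" and dir: "directed X n \<alpha> v"
  shows "untwisted n X e \<alpha> \<in> carrier (mother_group Z e)"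
proof -
  have v: "v \<in> nlists n X" "state X \<alpha> v = \<alpha>" using dir by (auto simp: directed_def)
  note vl = nlists_lists[OF v(1)]
  note \<tau> = half_twist_permutes[OF e]
  let ?\<pi> = "restrict_id \<alpha> Z"
  let ?a = "\<lambda>z. restrict_id (state X \<alpha> z) Z"
  have \<pi>: "?\<pi> permutes Z" by (rule restrict_id_nlists_permutes[OF \<alpha>])
  \<comment> \<open>Since the state at \<open>v\<close> is \<open>\<alpha>\<close>, the letter
    \<open>x\<close> is mapped to \<open>x'\<close> and has state \<open>\<alpha>\<close> again;
    both are doubled words, so their own half twists move them to \<open>e\<close>.\<close>
  define x x' where "x = v @ v" and "x' = \<alpha> v @ \<alpha> v"
  have x: "x \<in> Z" "x' \<in> Z"
    using v(1) is_tree_aut_nlists[OF \<alpha> v(1)] by (simp_all add: x_def x'_def append_nlists)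
  have xe: "\<tau> x x = e" "\<tau> x' x' = e"
    unfolding x_def x'_def
    by (rule half_twist_double, rule v(1), rule half_twist_double, rule is_tree_aut_nlists[OF \<alpha> v(1)])
  have \<alpha>x: "\<alpha> x = x'" using state_append[OF \<alpha> vl vl] v(2) by (simp add: x_def x'_def)
  have sx: "state X \<alpha> x = \<alpha>" using state_state[OF \<alpha> vl vl] v(2) by (simp add: x_def)
  have rt: "rooted X n (state X \<alpha> y)" if y: "y \<in> Z" "y \<noteq> x" for y
  proof -
    obtain u w where uw: "u \<in> nlists n X" "w \<in> nlists n X" "y = u @ w"
      using y(1) by (rule nlists_add_split)
    have s: "state X \<alpha> y = state X (state X \<alpha> u) w"
      using state_state[OF \<alpha>] uw nlists_lists by metis
    show ?thesis
    \<comment> \<open>After \<open>v\<close> the automorphism starts afresh, and \<open>w\<close>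
      differs from \<open>v\<close>; after any other \<open>u\<close> the state is rooted and
      \<open>w\<close> uses up its depth.\<close>
    proof (cases "u = v")
      case True
      then have "w \<noteq> v" using y uw by (auto simp: x_def)
      then show ?thesis using s True v dir uw by (simp add: directed_def)
    next
      case False
      then have "state X \<alpha> y = id" using s dir uw by (simp add: directed_def rooted_def)
      then show ?thesis using rooted_id by metis
    qed
  qed
  have st: "is_tree_aut X (state X \<alpha> y)" if "y \<in> Z" for y
    by (rule is_tree_aut_state[OF \<alpha> nlists_lists[OF that]])
  obtain b where b: "b \<in> carrier (wreath (Sym Z) (Z - {e}))"
    "\<And>r. r \<in> lists Z \<Longrightarrow> twist \<tau> x' (block_act X \<alpha> r) = B_act e b (twist \<tau> x r)"
  proof (rule twist_B_act[OF \<tau> x xe \<pi>, where a = ?a and f = "block_act X \<alpha>"])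
    show "?\<pi> x = x'" using x \<alpha>x by simp
    show "?a y permutes Z" if "y \<in> Z" "y \<noteq> x" for y
      by (rule restrict_id_nlists_permutes[OF st[OF that(1)]])
    show "\<tau> (?a y z) = \<tau> z" if "y \<in> Z" "y \<noteq> x" "z \<in> Z" for y z
      using that rooted_drop[OF st[OF that(1)] rt[OF that(1,2)] that(3)]
      by (simp add: half_twist_def)
    show "block_act X \<alpha> (x # w) = x' # block_act X \<alpha> w" for w
      unfolding block_act.simps sx \<alpha>x by (rule refl)
    show "block_act X \<alpha> (y # w) = ?\<pi> y # A_act (?a y) w"
      if "y \<in> Z" "y \<noteq> x" "w \<in> lists Z" for y w
      using that rooted_block_act[OF st[OF that(1)] rt[OF that(1,2)] that(3)] by simp
  qed auto
  let ?A = "\<lambda>c d. restrict_id (A_act (\<tau> d \<circ> inv_into UNIV (\<tau> c))) (lists Z)"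
  have A: "?A c d \<in> carrier (mother_group Z e)" if "c \<in> Z" "d \<in> Z" for c d
    by (intro mother_A_in_mother permutes_compose permutes_inv \<tau> that)
  \<comment> \<open>From the right: the parameter \<open>e\<close> becomes \<open>x\<close>, the
    element of \<open>B\<close> acts, and the parameter \<open>x'\<close> becomes
    \<open>e\<close>.\<close>
  let ?m = "?A x' e \<circ> (restrict_id (B_act e b) (lists Z) \<circ> ?A e x)"
  have m: "?m \<in> carrier (mother_group Z e)"
    by (intro mother_comp A mother_B_in_mother b x e)
  have "?m (twist \<tau> e r) = twist \<tau> e (block_act X \<alpha> r)" if r: "r \<in> lists Z" for r
  proof -
    note l = block_act_lists[OF \<alpha> r]
    have A_eq: "?A c d (twist \<tau> c w) = twist \<tau> d w" if "c \<in> Z" "w \<in> lists Z" for c d w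
      using twist_untwist(1)[OF \<tau> that] twist_change[OF \<tau> that(1), where d = d and w = w] by simp
    show ?thesis
      using A_eq[OF e r] A_eq[OF x(2) l] b(2)[OF r] twist_untwist(1)[OF \<tau> x(1) r] by simp
  qed
  then have "untwisted n X e \<alpha> = ?m"
    by (rule untwisted_eqI[OF \<alpha> mother_tree_aut[OF m]])
  with m show ?thesis by simp
qed

end


subsection \<open>Bounded automatic automorphisms\<close>

definition finitary :: "'a set \<Rightarrow> ('a list \<Rightarrow> 'a list) \<Rightarrow> bool" where
  "finitary X \<alpha> \<longleftrightarrow> (\<exists>n. rooted X n \<alpha>)"

text \<open>The sum of the separate bounds is at least each of them, and it exists for the empty set
  too.\<close>

lemma finite_uniform_bound:
  fixes P :: "'b \<Rightarrow> nat \<Rightarrow> bool"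
  assumes "finite A" "\<And>x. x \<in> A \<Longrightarrow> \<exists>k. P x k" "\<And>x k l. x \<in> A \<Longrightarrow> P x k \<Longrightarrow> k \<le> l \<Longrightarrow> P x l"
  shows "\<exists>k. \<forall>x\<in>A. P x k"
proof -
  obtain f where f: "\<And>x. x \<in> A \<Longrightarrow> P x (f x)" using assms(2) by metis
  have "P x (sum f A)" if x: "x \<in> A" for x
  proof -
    have "f x \<le> sum f A" by (rule member_le_sum) (use x assms(1) in simp_all)
    then show ?thesis by (rule assms(3)[OF x f[OF x]])
  qed
  then show ?thesis by blast
qed

lemma finitary_state:
  assumes "is_tree_aut X \<alpha>" "finitary X \<alpha>" "u \<in> lists X"
  shows "finitary X (state X \<alpha> u)"
proof -
  obtain n where n: "rooted X n \<alpha>" using assms(2) by (auto simp: finitary_def)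
  have "rooted X n (state X \<alpha> u)"
    unfolding rooted_def
  proof
    fix w assume w: "w \<in> nlists n X"
    have "u @ w \<in> nlists (length u + n) X" using assms(3) w by (simp add: nlists_iff)
    then have "state X \<alpha> (u @ w) = id"
      using rooted_mono[OF assms(1) n, of "length u + n"] by (simp add: rooted_def)
    then show "state X (state X \<alpha> u) w = id"
      by (simp add: state_state[OF assms(1,3) nlists_lists[OF w]])
  qed
  then show ?thesis by (auto simp: finitary_def)
qed

text \<open>Otherwise finiteness of level \<open>n\<close> would give all its states a common depth
  \<open>k\<close>, and \<open>\<alpha>\<close> would be rooted at depth
  \<open>n + k\<close>.\<close>

lemma not_finitary_state:
  assumes "finite X" "is_tree_aut X \<alpha>" "\<not> finitary X \<alpha>"
  shows "\<exists>u\<in>nlists n X. \<not> finitary X (state X \<alpha> u)"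
proof (rule ccontr)
  assume "\<not> ?thesis"
  then have fin: "\<exists>k. rooted X k (state X \<alpha> u)" if "u \<in> nlists n X" for u
    using that by (auto simp: finitary_def)
  have "\<exists>k. \<forall>u\<in>nlists n X. rooted X k (state X \<alpha> u)"
  proof (rule finite_uniform_bound[OF finite_nlists[OF assms(1)] fin])
    show "rooted X l (state X \<alpha> u)"
      if "u \<in> nlists n X" "rooted X k (state X \<alpha> u)" "k \<le> l" for u k l
      by (rule rooted_mono[OF is_tree_aut_state[OF assms(2) nlists_lists[OF that(1)]] that(2,3)])
  qed
  then obtain k where k: "\<And>u. u \<in> nlists n X \<Longrightarrow> rooted X k (state X \<alpha> u)" by blast
  have "rooted X (n + k) \<alpha>"
    unfolding rooted_def
  proof
    fix w assume "w \<in> nlists (n + k) X"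
    then obtain u v where "u \<in> nlists n X" "v \<in> nlists k X" "w = u @ v"
      by (rule nlists_add_split)
    then show "state X \<alpha> w = id"
      using k[of u] state_state[OF assms(2) nlists_lists nlists_lists, of u n v k]
      by (simp add: rooted_def)
  qed
  with assms(3) show False by (auto simp: finitary_def)
qed

text \<open>The number of words of length \<open>k\<close> with a state that is not finitary is bounded and
  does not decrease with \<open>k\<close>. Once it is maximal, such a word has only one extension of any
  given length with a state that is not finitary.\<close>

lemma not_finitary_unique:
  assumes "finite X" and \<alpha>: "is_tree_aut X \<alpha>" and "bounded_aut X \<alpha>"
  shows "\<exists>K. \<forall>w\<in>lists X. length w \<ge> K \<longrightarrow> (\<forall>n. \<forall>u\<in>nlists n X. \<forall>u'\<in>nlists n X.
    \<not> finitary X (state X \<alpha> (w @ u)) \<longrightarrow> \<not> finitary X (state X \<alpha> (w @ u')) \<longrightarrow> u = u')"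
proof -
  define W where "W k = {w \<in> nlists k X. \<not> finitary X (state X \<alpha> w)}" for k
  have fin: "finite (W k)" for k using finite_nlists[OF assms(1)] by (simp add: W_def)
  obtain C where C: "card {w \<in> nlists k X. state X \<alpha> w \<noteq> id} \<le> C" for k
    using assms(3) unfolding bounded_aut_def by blast
  have "card (W k) < Suc C" for k
  proof -
    have "finitary X id" using rooted_id by (auto simp: finitary_def)
    then have "W k \<subseteq> {w \<in> nlists k X. state X \<alpha> w \<noteq> id}" by (auto simp: W_def)
    then have "card (W k) \<le> card {w \<in> nlists k X. state X \<alpha> w \<noteq> id}"
      by (intro card_mono) (simp_all add: finite_nlists assms(1))
    with C[of k] show ?thesis by linarith
  qed
  then obtain K where K: "card (W k) \<le> card (W K)" for k
    using ex_has_greatest_nat[of "\<lambda>_. True" 0 "\<lambda>k. card (W k)" "Suc C"] by auto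
  \<comment> \<open>The prefixes cover \<open>W K\<close>, as each vertex there has a descendant
    with a state that is not finitary; maximality of \<open>card (W K)\<close> then forbids two
    words with the same prefix.\<close>
  have inj: "inj_on (take K) (W (K + k))" for k
  proof (rule eq_card_imp_inj_on[OF fin])
    have "W K \<subseteq> take K ` W (K + k)"
    proof
      fix w assume w: "w \<in> W K"
      then have wl: "w \<in> lists X" "length w = K" by (simp_all add: W_def nlists_iff)
      obtain u where u: "u \<in> nlists k X" "\<not> finitary X (state X (state X \<alpha> w) u)"
        using not_finitary_state[OF assms(1) is_tree_aut_state[OF \<alpha> wl(1)], of k] w
        by (auto simp: W_def)
      then have "w @ u \<in> W (K + k)"
        using w append_nlists state_state[OF \<alpha> wl(1) nlists_lists[OF u(1)]]
        by (auto simp: W_def)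
      then show "w \<in> take K ` W (K + k)" using wl by (intro image_eqI[of _ _ "w @ u"]) simp_all
    qed
    then have "card (W K) \<le> card (take K ` W (K + k))" by (intro card_mono finite_imageI fin)
    then show "card (take K ` W (K + k)) = card (W (K + k))"
      using card_image_le[OF fin, of "take K" "K + k"] K[of "K + k"] by linarith
  qed
  show ?thesis
  proof (intro exI ballI allI impI)
    fix w n u u'
    assume w: "w \<in> lists X" "K \<le> length w" and u: "u \<in> nlists n X" "u' \<in> nlists n X"
      "\<not> finitary X (state X \<alpha> (w @ u))" "\<not> finitary X (state X \<alpha> (w @ u'))"
    \<comment> \<open>Both words lie \<open>?k\<close> levels below level \<open>K\<close> and share
      their first \<open>K\<close> letters.\<close>
    let ?k = "length w - K + n"
    have "w @ u \<in> nlists (K + ?k) X" "w @ u' \<in> nlists (K + ?k) X"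
      using w u by (simp_all add: nlists_iff)
    then have W: "w @ u \<in> W (K + ?k)" "w @ u' \<in> W (K + ?k)" using u by (simp_all add: W_def)
    have "take K (w @ u) = take K (w @ u')" using w by simp
    from inj_onD[OF inj this W] show "u = u'" by simp
  qed
qed

section \<open>Idempotent powers of a self-map of a finite set\<close>

lemma funpow_in: "f \<in> A \<rightarrow> A \<Longrightarrow> x \<in> A \<Longrightarrow> (f ^^ k) x \<in> A"
  by (induction k) auto

lemma funpow_funpow: "(f ^^ m) ((f ^^ n) x) = (f ^^ (m + n)) x"
  by (simp add: funpow_add)

text \<open>Two powers coincide on a finite set, so the powers are eventually periodic; a multiple
  of the period beyond the preperiod is an idempotent exponent.\<close>

lemma funpow_idempotent:
  assumes "finite A" and f: "f \<in> A \<rightarrow> A"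
  obtains m where "m \<ge> K" "m > 0" "\<And>x. x \<in> A \<Longrightarrow> (f ^^ m) ((f ^^ m) x) = (f ^^ m) x"
proof -
  have "range (\<lambda>k. restrict (f ^^ k) A) \<subseteq> A \<rightarrow>\<^sub>E A"
    using funpow_in[OF f] by (auto intro!: restrict_PiE_iff[THEN iffD2])
  then have "finite (range (\<lambda>k. restrict (f ^^ k) A))"
    using finite_PiE[OF assms(1), of "\<lambda>_. A"] assms(1) finite_subset by blast
  then have "\<not> inj (\<lambda>k. restrict (f ^^ k) A)"
    using finite_imageD infinite_UNIV_nat by blast
  then obtain k l where "k \<noteq> l" "restrict (f ^^ k) A = restrict (f ^^ l) A"
    unfolding inj_def by blast
  then obtain i j where ij: "i < j" "restrict (f ^^ i) A = restrict (f ^^ j) A"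
    by (cases "k < l") (auto simp: not_less order_le_less)
  define p where "p = j - i"
  have per: "(f ^^ (k + p)) x = (f ^^ k) x" if "x \<in> A" "i \<le> k" for k x
  proof -
    have "k + p = k - i + j" using ij(1) that(2) by (simp add: p_def)
    then have "(f ^^ (k + p)) x = (f ^^ (k - i)) ((f ^^ j) x)" by (simp only: funpow_funpow)
    also have "(f ^^ j) x = (f ^^ i) x" using fun_cong[OF ij(2), of x] that by simp
    also have "(f ^^ (k - i)) ((f ^^ i) x) = (f ^^ k) x"
      using that(2) by (simp add: funpow_funpow)
    finally show ?thesis .
  qed
  have periods: "(f ^^ (k + t * p)) x = (f ^^ k) x" if "x \<in> A" "i \<le> k" for k t x
  proof (induction t)
    case (Suc t)
    have "(f ^^ (k + t * p + p)) x = (f ^^ (k + t * p)) x" using that by (intro per) auto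
    with Suc show ?case by (simp add: add_ac)
  qed simp
  \<comment> \<open>A multiple of the period \<open>p\<close> that exceeds the preperiod
    \<open>i\<close> and \<open>K\<close>; the summand 1 keeps it positive.\<close>
  define m where "m = (i + K + 1) * p"
  have "p \<ge> 1" using ij(1) by (simp add: p_def)
  then have m: "m \<ge> i + K + 1"
    unfolding m_def using mult_le_mono2[of 1 p "i + K + 1"] by (simp only: mult_1_right)
  have "(f ^^ m) ((f ^^ m) x) = (f ^^ m) x" if "x \<in> A" for x
  proof -
    have "i \<le> m" using m by linarith
    from periods[OF that this, of "i + K + 1"] show ?thesis
      unfolding funpow_funpow m_def[symmetric] .
  qed
  moreover have "K \<le> m" "0 < m" using m by linarith+
  ultimately show ?thesis by (intro that[of m])
qed

text \<open>Following the unique letter with a state that is not finitary defines a self-map of a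
  finite set of states; \<open>n\<close> is chosen such that its \<open>n\<close>-th power is idempotent.\<close>

lemma rooted_or_directed:
  assumes "finite X" "finite S" and S: "\<And>s. s \<in> S \<Longrightarrow> is_tree_aut X s"
    and bd: "\<And>s. s \<in> S \<Longrightarrow> bounded_aut X s" and at: "\<And>s. s \<in> S \<Longrightarrow> automatic X s"
  obtains n where "n > 0" "\<And>s w. s \<in> S \<Longrightarrow> w \<in> nlists (n + n) X \<Longrightarrow>
    rooted X n (state X s w) \<or> (\<exists>v. directed X n (state X s w) v)"
proof -
  \<comment> \<open>All states of the given automorphisms: a finite set, closed under taking
    states.\<close>
  define Q where "Q = (\<Union>s\<in>S. {state X s w | w. w \<in> lists X})"
  define R where "R = {q \<in> Q. \<not> finitary X q}"
  have finQ: "finite Q" using assms(2) at by (simp add: Q_def automatic_def)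
  have QI: "state X s w \<in> Q" if "s \<in> S" "w \<in> lists X" for s w
    using that by (auto simp: Q_def)
  have Qt: "is_tree_aut X q" if "q \<in> Q" for q
    using that is_tree_aut_state S by (auto simp: Q_def)
  have Qs: "state X q u \<in> Q" if "q \<in> Q" "u \<in> lists X" for q u
  proof -
    obtain s w where sw: "s \<in> S" "w \<in> lists X" "q = state X s w" using \<open>q \<in> Q\<close> by (auto simp: Q_def)
    then have "state X q u = state X s (w @ u)" "w @ u \<in> lists X"
      using state_state[OF S[OF sw(1)] sw(2) that(2)] that(2) by simp_all
    then show ?thesis using QI sw(1) by simp
  qed
  have "\<exists>d. \<forall>q\<in>Q - R. rooted X d q"
  proof (rule finite_uniform_bound)
    show "finite (Q - R)" using finQ by simp
    show "\<exists>k. rooted X k q" if "q \<in> Q - R" for q using that by (auto simp: R_def finitary_def)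
    show "rooted X l q" if "q \<in> Q - R" "rooted X k q" "k \<le> l" for q k l
      using that rooted_mono Qt by blast
  qed
  then obtain d where d: "\<And>q. q \<in> Q - R \<Longrightarrow> rooted X d q" by blast
  let ?uniq = "\<lambda>s K. \<forall>w\<in>lists X. length w \<ge> K \<longrightarrow> (\<forall>n. \<forall>u\<in>nlists n X. \<forall>u'\<in>nlists n X.
    \<not> finitary X (state X s (w @ u)) \<longrightarrow> \<not> finitary X (state X s (w @ u')) \<longrightarrow> u = u')"
  have "\<exists>K. \<forall>s\<in>S. ?uniq s K"
  proof (rule finite_uniform_bound[OF assms(2)])
    show "\<exists>K. ?uniq s K" if "s \<in> S" for s
      using not_finitary_unique[OF assms(1) S[OF that] bd[OF that]] .
    show "?uniq s l" if "?uniq s k" "k \<le> l" for s k l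
      using that by (meson order_trans)
  qed
  then obtain K where K: "\<forall>s\<in>S. ?uniq s K" ..
  have "\<exists>r\<in>R. \<exists>x\<in>X. r = state X q [x]" if q: "q \<in> R" for q
  proof -
    have q': "q \<in> Q" "\<not> finitary X q" using q by (auto simp: R_def)
    obtain u where u: "u \<in> nlists 1 X" "\<not> finitary X (state X q u)"
      using not_finitary_state[OF assms(1) Qt[OF q'(1)] q'(2)] by blast
    then obtain x where x: "u = [x]" "x \<in> X" by (auto simp: nlists_iff length_Suc_conv)
    then have "state X q [x] \<in> R" using u Qs[OF q'(1), of u] by (simp add: R_def)
    with x show ?thesis by blast
  qed
  \<comment> \<open>A choice made once per state, not per vertex; it is forced only at vertices of
    depth at least \<open>K\<close>.\<close>
  then obtain \<phi> where \<phi>: "\<And>q. q \<in> R \<Longrightarrow> \<phi> q \<in> R \<and> (\<exists>x\<in>X. \<phi> q = state X q [x])"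
    by metis
  have \<phi>R: "\<phi> \<in> R \<rightarrow> R" using \<phi> by auto
  have \<phi>n: "\<exists>v\<in>nlists n X. (\<phi> ^^ n) q = state X q v" if q: "q \<in> R" for n q
  proof (induction n)
    case 0
    have "is_tree_aut X q" using q Qt by (simp add: R_def)
    then show ?case by (simp add: state_Nil)
  next
    case (Suc n)
    then obtain v where v: "v \<in> nlists n X" "(\<phi> ^^ n) q = state X q v" by blast
    obtain x where x: "x \<in> X" "\<phi> (state X q v) = state X (state X q v) [x]"
      using \<phi>[OF funpow_in[OF \<phi>R q, of n]] v by auto
    have "state X (state X q v) [x] = state X q (v @ [x])"
      using q x v by (intro state_state Qt) (simp_all add: R_def nlists_lists)
    moreover have "v @ [x] \<in> nlists (Suc n) X" using v x by (simp add: nlists_iff)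
    ultimately show ?case using v x by (intro bexI[of _ "v @ [x]"]) simp_all
  qed
  \<comment> \<open>At depth \<open>n\<close>, uniqueness holds since \<open>n \<ge> K\<close>, and
    the finitary states in \<open>Q\<close> are rooted since \<open>n \<ge> d\<close>.\<close>
  obtain n where n: "n \<ge> K + d" "n > 0" and idem: "\<And>q. q \<in> R \<Longrightarrow> (\<phi> ^^ n) ((\<phi> ^^ n) q) = (\<phi> ^^ n) q"
    using funpow_idempotent[OF _ \<phi>R, of "K + d"] finQ by (auto simp: R_def)
  have root: "rooted X n q" if "q \<in> Q - R" for q
    using rooted_mono[OF Qt d[OF that]] that n by auto
  have "rooted X n (state X s w) \<or> (\<exists>v. directed X n (state X s w) v)"
    if s: "s \<in> S" and w: "w \<in> nlists (n + n) X" for s w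
  proof (cases "state X s w \<in> R")
    case False
    then show ?thesis using root QI[OF s nlists_lists[OF w]] by blast
  next
    case True
    let ?q = "state X s w"
    \<comment> \<open>The first half reaches a depth with uniqueness; the second is then forced to
      follow \<open>\<phi>\<close>, so the state at \<open>w\<close> is a value of the idempotent
      power.\<close>
    obtain w1 w2 where w12: "w1 \<in> nlists n X" "w2 \<in> nlists n X" "w = w1 @ w2"
      using w by (rule nlists_add_split)
    note l = nlists_lists[OF w12(1)] nlists_lists[OF w12(2)]
    have uq: "u = u'" if "v \<in> nlists (m + n) X" "u \<in> nlists n X" "u' \<in> nlists n X"
      "state X s (v @ u) \<in> R" "state X s (v @ u') \<in> R" for v u u' m
      proof -
      have "v \<in> lists X" "K \<le> length v" using that(1) n(1) by (simp_all add: nlists_iff)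
      then show ?thesis using bspec[OF K s] that(2-5) by (simp add: R_def)
    qed
    let ?p = "state X s w1"
    have p: "?p \<in> R"
      using True finitary_state[OF is_tree_aut_state[OF S[OF s] l(1)] _ l(2)]
        state_state[OF S[OF s] l] QI[OF s l(1)] by (auto simp: R_def w12(3))
    obtain v where v: "v \<in> nlists n X" "(\<phi> ^^ n) ?p = state X ?p v" using \<phi>n[OF p] by blast
    have "state X ?p v = state X s (w1 @ v)"
      by (rule state_state[OF S[OF s] l(1) nlists_lists[OF v(1)]])
    then have "v = w2"
      using uq[of w1 0 v w2] w12 v True funpow_in[OF \<phi>R p, of n] by simp
    then have pq: "(\<phi> ^^ n) ?p = ?q" using v(2) state_state[OF S[OF s] l] w12(3) by simp
    obtain v' where v': "v' \<in> nlists n X" "(\<phi> ^^ n) ?q = state X ?q v'"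
      using \<phi>n[OF True] by blast
    \<comment> \<open>The idempotent power fixes its value \<open>?q\<close>, so \<open>?q\<close>
      recurs along \<open>v'\<close>; uniqueness below \<open>w\<close> makes all other states on
      that level finitary.\<close>
    have qv: "state X ?q v' = ?q" using idem[OF p] pq v'(2) by simp
    have st: "state X ?q u = state X s (w @ u)" if "u \<in> nlists n X" for u
      by (rule state_state[OF S[OF s] nlists_lists[OF w] nlists_lists[OF that]])
    have "rooted X n (state X ?q u)" if "u \<in> nlists n X" "u \<noteq> v'" for u
    proof (rule root)
      have "state X ?q u \<notin> R"
        using uq[of w n u v'] w that v'(1) st[OF that(1)] st[OF v'(1)] qv True by auto
      then show "state X ?q u \<in> Q - R"
        using Qs[OF QI[OF s nlists_lists[OF w]] nlists_lists[OF that(1)]] by simp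
    qed
    then show ?thesis using v'(1) qv by (auto simp: directed_def)
  qed
  with n(2) show ?thesis by (rule that)
qed


subsection \<open>The embedding\<close>

lemma tree_aut_m_inv:
  assumes "is_tree_aut X \<alpha>" shows "inv\<^bsub>tree_aut X\<^esub> \<alpha> = inv_into UNIV \<alpha>"
  using is_tree_aut_inv[OF assms] assms permutes_inv_o[OF is_tree_autD(1)[OF assms]]
  by (intro group.inv_equality[OF group_tree_aut]) (simp_all add: tree_aut_def)

text \<open>\<open>BA X\<close> has not been shown to be a group, so \<open>m_inv\<close> is
  unfolded; a two-sided inverse function is unique.\<close>

lemma BA_m_inv:
  assumes "finite X" "\<alpha> \<in> carrier (BA X)" shows "inv\<^bsub>BA X\<^esub> \<alpha> = inv_into UNIV \<alpha>"
  unfolding m_inv_def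
proof (rule the_equality)
  have \<alpha>: "is_tree_aut X \<alpha>" using assms(2) by (simp add: BA_def tree_aut_def)
  note o = permutes_inv_o[OF is_tree_autD(1)[OF \<alpha>]]
  show "inv_into UNIV \<alpha> \<in> carrier (BA X) \<and> \<alpha> \<otimes>\<^bsub>BA X\<^esub> inv_into UNIV \<alpha> = \<one>\<^bsub>BA X\<^esub> \<and>
      inv_into UNIV \<alpha> \<otimes>\<^bsub>BA X\<^esub> \<alpha> = \<one>\<^bsub>BA X\<^esub>"
    using carrier_BA_inv[OF assms] by (simp add: BA_def tree_aut_def o)
  show "\<beta> = inv_into UNIV \<alpha>"
    if "\<beta> \<in> carrier (BA X) \<and> \<alpha> \<otimes>\<^bsub>BA X\<^esub> \<beta> = \<one>\<^bsub>BA X\<^esub> \<and> \<beta> \<otimes>\<^bsub>BA X\<^esub> \<alpha> = \<one>\<^bsub>BA X\<^esub>" for \<beta>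
    using that by (intro inv_unique_comp[symmetric]) (simp_all add: BA_def tree_aut_def)
qed

definition wreath_coords ::
    "nat \<Rightarrow> 'a set \<Rightarrow> 'a list \<Rightarrow> ('a list \<Rightarrow> 'a list) \<Rightarrow>
      ('a list \<Rightarrow> 'a list list \<Rightarrow> 'a list list) \<times> ('a list \<Rightarrow> 'a list)" where
  "wreath_coords n X e \<alpha> =
    (\<lambda>z\<in>nlists (n + n) X. untwisted n X e (state X \<alpha> z), restrict_id \<alpha> (nlists (n + n) X))"

text \<open>States of products and inverses are products and inverses of states at moved letters,
  and \<open>untwisted\<close> respects both, so the generators decide.\<close>

lemma generate_BA_untwisted:
  assumes "finite X" and e: "e \<in> nlists (n + n) X" and S: "S \<subseteq> carrier (BA X)"
    and gen: "\<And>s w. s \<in> S \<Longrightarrow> w \<in> nlists (n + n) X \<Longrightarrow>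
      untwisted n X e (state X s w) \<in> carrier (mother_group (nlists (n + n) X) e)"
    and "g \<in> generate (BA X) S"
  shows "is_tree_aut X g \<and> (\<forall>w\<in>nlists (n + n) X.
    untwisted n X e (state X g w) \<in> carrier (mother_group (nlists (n + n) X) e))"
  using assms(5)
proof induction
  have u1: "untwisted n X e id \<in> carrier (mother_group (nlists (n + n) X) e)"
    by (rule untwisted_rooted[OF e is_tree_aut_id rooted_id])
  case one
  have "\<one>\<^bsub>BA X\<^esub> = id" by (simp add: BA_def tree_aut_def)
  then show ?case using u1 is_tree_aut_id by (metis state_id)
next
  case (incl h)
  then show ?case using S gen by (auto simp: BA_def tree_aut_def)
next
  let ?Z = "nlists (n + n) X"
  let ?M = "mother_group ?Z e"
  case (inv h)
  then have h: "is_tree_aut X h" using S by (auto simp: BA_def tree_aut_def)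
  note h' = is_tree_aut_inv[OF h]
  \<comment> \<open>At \<open>w\<close> the inverse has the inverted state of \<open>h\<close> at
    the preimage of \<open>w\<close>, again a letter, so \<open>gen\<close> applies there.\<close>
  have "untwisted n X e (state X (inv_into UNIV h) w) \<in> carrier ?M" if w: "w \<in> ?Z" for w
  proof -
    let ?v = "inv_into UNIV h w"
    let ?q = "state X h ?v"
    have v: "?v \<in> ?Z" by (rule is_tree_aut_nlists[OF h' w])
    have q: "is_tree_aut X ?q" by (rule is_tree_aut_state[OF h nlists_lists[OF v]])
    note uq = is_tree_aut_untwisted[OF e q]
    have um: "untwisted n X e ?q \<in> carrier ?M" by (rule gen[OF inv v])
    have "untwisted n X e ?q \<circ> untwisted n X e (inv_into UNIV ?q) = untwisted n X e id"
      using untwisted_comp[OF e is_tree_aut_inv[OF q] q]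
        permutes_inv_o(1)[OF is_tree_autD(1)[OF q]] by simp
    also have "\<dots> = id"
      by (rule untwisted_eqI[OF e is_tree_aut_id is_tree_aut_id]) (simp add: block_act_id)
    finally have "untwisted n X e ?q \<circ> untwisted n X e (inv_into UNIV ?q) = id" .
    then have "untwisted n X e (inv_into UNIV ?q) = inv\<^bsub>tree_aut ?Z\<^esub> (untwisted n X e ?q)"
      using uq is_tree_aut_untwisted[OF e is_tree_aut_inv[OF q]]
      by (intro group.inv_equality[OF group_tree_aut, symmetric]) (simp_all add: tree_aut_def)
    also have "\<dots> \<in> carrier ?M"
      using um mother_A_tree_aut[of ?Z] mother_B_tree_aut[OF e]
      by (auto simp: mother_group_def intro!: group.generate_m_inv_closed[OF group_tree_aut])
    finally show ?thesis by (simp add: state_inv[OF h nlists_lists[OF w]])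
  qed
  moreover have "inv\<^bsub>BA X\<^esub> h = inv_into UNIV h" using inv S by (intro BA_m_inv assms(1)) auto
  ultimately show ?case using h' by simp
next
  case (eng h1 h2)
  have eq: "h1 \<otimes>\<^bsub>BA X\<^esub> h2 = h2 \<circ> h1" by (simp add: BA_def tree_aut_def)
  have h: "is_tree_aut X h1" "is_tree_aut X h2" using eng by auto
  have "untwisted n X e (state X (h2 \<circ> h1) w) \<in> carrier (mother_group (nlists (n + n) X) e)"
    if w: "w \<in> nlists (n + n) X" for w
  proof -
    note l = nlists_lists[OF w] nlists_lists[OF is_tree_aut_nlists[OF h(1) w]]
    have "untwisted n X e (state X (h2 \<circ> h1) w) =
        untwisted n X e (state X h2 (h1 w)) \<circ> untwisted n X e (state X h1 w)"
      unfolding state_comp[OF h l(1)]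
      by (rule untwisted_comp[OF e is_tree_aut_state[OF h(1) l(1)] is_tree_aut_state[OF h(2) l(2)]])
    then show ?thesis
      using mother_comp[OF e] eng.IH w is_tree_aut_nlists[OF h(1) w] by simp
  qed
  then show ?case unfolding eq using is_tree_aut_comp[OF h] by blast
qed

text \<open>In the state of the product at \<open>w\<close>, the state of \<open>\<beta>\<close> is
  taken at \<open>\<alpha> w\<close>: this is the shift of coordinates in the wreath
  product.\<close>

lemma wreath_coords_mult:
  assumes e: "e \<in> nlists (n + n) X" and h: "is_tree_aut X \<alpha>" "is_tree_aut X \<beta>"
  shows "wreath_coords n X e (\<beta> \<circ> \<alpha>) = wreath_coords n X e \<alpha>
    \<otimes>\<^bsub>wreath (mother_group (nlists (n + n) X) e) (nlists (n + n) X)\<^esub> wreath_coords n X e \<beta>"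
proof -
  have "untwisted n X e (state X (\<beta> \<circ> \<alpha>) w) =
      untwisted n X e (state X \<beta> (\<alpha> w)) \<circ> untwisted n X e (state X \<alpha> w)"
    if w: "w \<in> nlists (n + n) X" for w
  proof -
    note l = nlists_lists[OF w] nlists_lists[OF is_tree_aut_nlists[OF h(1) w]]
    show ?thesis unfolding state_comp[OF h l(1)]
      by (rule untwisted_comp[OF e is_tree_aut_state[OF h(1) l(1)] is_tree_aut_state[OF h(2) l(2)]])
  qed
  then show ?thesis
    using is_tree_aut_nlists[OF h(1)]
    by (auto simp: wreath_coords_def wreath_def mother_group_def tree_aut_def Sym_def
        fun_eq_iff restrict_def restrict_id_def)
qed

text \<open>An automorphism is determined by its action on words of length \<open>n + n\<close> and
  its states there, and conjugation loses no state.\<close>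

lemma wreath_coords_inj:
  assumes "X \<noteq> {}" "n > 0" and e: "e \<in> nlists (n + n) X"
    and h: "is_tree_aut X \<alpha>" "is_tree_aut X \<beta>"
    and eq: "wreath_coords n X e \<alpha> = wreath_coords n X e \<beta>"
  shows "\<alpha> = \<beta>"
proof (rule block_aut_inj[OF assms(1) _ h])
  have z: "\<alpha> z = \<beta> z" "state X \<alpha> z = state X \<beta> z" if z: "z \<in> nlists (n + n) X" for z
  proof -
    note l = nlists_lists[OF z]
    have "untwisted n X e (state X \<alpha> z) = untwisted n X e (state X \<beta> z)"
      using eq z by (auto simp: wreath_coords_def fun_eq_iff restrict_def split: if_splits)
    then show "state X \<alpha> z = state X \<beta> z"
      by (rule untwisted_inj[OF e assms(1,2) is_tree_aut_state[OF h(1) l] is_tree_aut_state[OF h(2) l]])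
    have "restrict_id \<alpha> (nlists (n + n) X) z = restrict_id \<beta> (nlists (n + n) X) z"
      using eq by (simp add: wreath_coords_def)
    then show "\<alpha> z = \<beta> z" using z by simp
  qed
  have "block_act X \<alpha> r = block_act X \<beta> r" if "r \<in> lists (nlists (n + n) X)" for r
  proof (cases r)
    case (Cons a w)
    then have "a \<in> nlists (n + n) X" using that by simp
    then show ?thesis unfolding Cons block_act.simps by (simp only: z)
  qed simp
  then show "block_aut (n + n) X \<alpha> = block_aut (n + n) X \<beta>"
    by (auto simp: block_aut_def restrict_id_def)
qed (use assms(2) in simp)

theorem theorem3p3:
  fixes X :: "'a set" and G :: "('a list \<Rightarrow> 'a list) set"
  assumes "finite X" and "X \<noteq> {}"
    and "subgroup G (BA X)"
    and "\<exists>S. finite S \<and> S \<subseteq> carrier (BA X) \<and> G = generate (BA X) S"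
  shows "\<exists>N>0. \<forall>e\<in>nlists N X. \<exists>H.
           subgroup H (wreath (mother_group (nlists N X) e) (nlists N X)) \<and>
           (BA X)\<lparr>carrier := G\<rparr> \<cong> (wreath (mother_group (nlists N X) e) (nlists N X))\<lparr>carrier := H\<rparr>"
proof -
  obtain S where S: "finite S" "S \<subseteq> carrier (BA X)" "G = generate (BA X) S"
    using assms(4) by blast
  have Sc: "is_tree_aut X s \<and> bounded_aut X s \<and> automatic X s" if "s \<in> S" for s
    using S(2) that by (auto simp: BA_def tree_aut_def)
  \<comment> \<open>\<open>n\<close> depends on the generators only, so one \<open>N\<close> serves
    every \<open>e\<close>.\<close>
  obtain n where n: "n > 0" and rd: "\<And>s w. s \<in> S \<Longrightarrow> w \<in> nlists (n + n) X \<Longrightarrow>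
      rooted X n (state X s w) \<or> (\<exists>v. directed X n (state X s w) v)"
    using rooted_or_directed[OF assms(1) S(1)] Sc by metis
  let ?Z = "nlists (n + n) X"
  have GB: "G \<subseteq> carrier (BA X)" by (rule subgroup.subset[OF assms(3)])
  \<comment> \<open>\<open>BA X\<close> and \<open>tree_aut X\<close> differ only in their carriers;
    the group structure of \<open>G\<close> is taken from the latter, a known group.\<close>
  let ?G = "(tree_aut X)\<lparr>carrier := G\<rparr>"
  have G: "(BA X)\<lparr>carrier := G\<rparr> = ?G" by (simp add: BA_def)
  have "subgroup G (tree_aut X)"
  proof (rule group.subgroupI[OF group_tree_aut])
    show "G \<subseteq> carrier (tree_aut X)" using GB by (auto simp: BA_def)
    show "G \<noteq> {}" using subgroup.one_closed[OF assms(3)] by blast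
    show "inv\<^bsub>tree_aut X\<^esub> g \<in> G" if "g \<in> G" for g
    proof -
      have g: "g \<in> carrier (BA X)" "is_tree_aut X g"
        using that GB by (auto simp: BA_def tree_aut_def)
      show ?thesis
        using subgroup.m_inv_closed[OF assms(3) that]
        by (simp add: BA_m_inv[OF assms(1) g(1)] tree_aut_m_inv[OF g(2)])
    qed
    show "g \<otimes>\<^bsub>tree_aut X\<^esub> h \<in> G" if "g \<in> G" "h \<in> G" for g h
      using subgroup.m_closed[OF assms(3) that] by (simp add: BA_def)
  qed
  then have group_G: "group ?G" by (rule group.subgroup_imp_group[OF group_tree_aut])
  have "\<exists>H. subgroup H (wreath (mother_group ?Z e) ?Z) \<and>
      ?G \<cong> (wreath (mother_group ?Z e) ?Z)\<lparr>carrier := H\<rparr>" if e: "e \<in> ?Z" for e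
  proof (intro exI conjI)
    let ?W = "wreath (mother_group ?Z e) ?Z"
    let ?\<Phi> = "wreath_coords n X e"
    have gen: "untwisted n X e (state X s w) \<in> carrier (mother_group ?Z e)"
      if "s \<in> S" "w \<in> ?Z" for s w
    proof -
      have "is_tree_aut X (state X s w)"
        using is_tree_aut_state Sc[OF that(1)] nlists_lists[OF that(2)] by blast
      then show ?thesis
        using rd[OF that] untwisted_rooted[OF e] untwisted_directed[OF e] by blast
    qed
    have Gt: "is_tree_aut X g \<and> (\<forall>w\<in>?Z. untwisted n X e (state X g w) \<in> carrier (mother_group ?Z e))"
      if "g \<in> G" for g
      using generate_BA_untwisted[OF assms(1) e S(2) gen] that S(3) by blast
    have "?\<Phi> g \<in> carrier ?W" if "g \<in> G" for g
      using Gt[OF that] restrict_id_nlists_permutes[of X g "n + n"]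
      by (simp add: wreath_coords_def wreath_def Sym_def)
    then have hom: "?\<Phi> \<in> hom ?G ?W"
      using wreath_coords_mult[OF e] Gt by (intro homI) (simp_all add: tree_aut_def)
    interpret group_hom ?G ?W ?\<Phi>
      using group_G group_wreath[OF group_mother_group[OF e]] hom
      by (simp add: group_hom_def group_hom_axioms_def)
    show "subgroup (?\<Phi> ` G) ?W" using img_is_subgroup by simp
    have "inj_on ?\<Phi> G"
      using wreath_coords_inj[OF assms(2) n e] Gt by (auto intro!: inj_onI)
    then have "?\<Phi> \<in> iso ?G (?W\<lparr>carrier := ?\<Phi> ` G\<rparr>)"
      using hom by (auto simp: iso_def hom_def bij_betw_def)
    then show "?G \<cong> ?W\<lparr>carrier := ?\<Phi> ` G\<rparr>" by (rule is_isoI)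
  qed
  with n show ?thesis by (intro exI[of _ "n + n"]) (simp add: G)
qed

end
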